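(* Let $d,t\geq 1$ and $s\geq 4$ be fixed integers. Then there is a constant $c=c(d,t,s)>0$ such that for every integer $n\geq 2$, $$R^{d,t}_3(s,n)\leq 2^{2^{c\sqrt{\log n\,\log\log n}}}.$$ In particular $R^{d,t}_3(s,n)\leq 2^{n^{o(1)}}$ as $n\to\infty$.
   Context: All logarithms are base 2. Let $P=\{p_1,\dots,p_N\}$ be a finite sequence of points in $\mathbb{R}^d$. A set $E\subset\binom{P}{k}$ is a $k$-ary semi-algebraic relation on $P$ of complexity at most $t$ if there are $t$ polynomials $f_1,\dots,f_t\in\mathbb{R}[x_1,\dots,x_{kd}]$ of degree at most $t$ and a Boolean function $\Phi$ such that for all $1\le i_1<\dots<i_k\le N$: $(p_{i_1},\dots,p_{i_k})\in E$ iff $\Phi(f_1(p_{i_1},\dots,p_{i_k})\ge 0,\dots,f_t(p_{i_1},\dots,p_{i_k})\ge 0)=1$. The relation is symmetric if this Boolean condition holds for $(p_{i_1},\dots,p_{i_k})$ iff it holds for every permutation of $(p_{i_1},\dots,p_{i_k})$. The Ramsey number $R^{d,t}_k(s,n)$ is the minimum integer $N$ such that every $N$-element point set $P\subset\mathbb{R}^d$ equipped with a symmetric $k$-ary semi-algebraic relation $E\subset\binom{P}{k}$ of complexity at most $t$ contains $s$ points all of whose $k$-subsets lie in $E$, or $n$ points none of whose $k$-subsets lie in $E$. *)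

theory Defs
  imports
    Complex_Main
    "HOL-Library.Poly_Mapping"
    "HOL-Library.Multiset"
    "HOL-Library.Ramsey"
    "HOL-Library.Extended_Real"
    "HOL-Library.Landau_Symbols"
begin

text \<open>
  A point of \<open>\<real>\<^sup>d\<close> is a real list of length \<open>d\<close>, so the \<open>k * d\<close> coordinates of a \<open>k\<close>-tuple of
  points are the entries of the concatenated list, in this order.
\<close>

type_synonym point = "real list"

definition points :: "nat \<Rightarrow> point set" where
  "points d = {p. length p = d}"

text \<open>
  Multivariate real polynomials, with variables indexed by \<^typ>\<open>nat\<close>: a finitely supported map
  from exponent vectors (themselves finitely supported) to coefficients.
\<close>

type_synonym real_mpoly = "(nat \<Rightarrow>\<^sub>0 nat) \<Rightarrow>\<^sub>0 real"

definition mpoly_value :: "real_mpoly \<Rightarrow> (nat \<Rightarrow> real) \<Rightarrow> real" where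
  "mpoly_value f x =
     (\<Sum>e\<in>Poly_Mapping.keys f.
        Poly_Mapping.lookup f e * (\<Prod>i\<in>Poly_Mapping.keys e. x i ^ Poly_Mapping.lookup e i))"

text \<open>Polynomials in the variables \<open>0, \<dots>, m - 1\<close> of total degree at most \<open>t\<close>.\<close>

definition mpolys :: "nat \<Rightarrow> nat \<Rightarrow> real_mpoly set" where
  "mpolys m t =
     {f. \<forall>e\<in>Poly_Mapping.keys f.
           Poly_Mapping.keys e \<subseteq> {..<m} \<and>
           (\<Sum>i\<in>Poly_Mapping.keys e. Poly_Mapping.lookup e i) \<le> t}"

text \<open>
  The Boolean condition \<open>\<Phi>(f\<^sub>1(q\<^sub>1, \<dots>, q\<^sub>k) \<ge> 0, \<dots>, f\<^sub>t(q\<^sub>1, \<dots>, q\<^sub>k) \<ge> 0)\<close>.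
\<close>

definition semialg_cond :: "real_mpoly list \<Rightarrow> (bool list \<Rightarrow> bool) \<Rightarrow> point list \<Rightarrow> bool" where
  "semialg_cond fs \<Phi> qs \<longleftrightarrow> \<Phi> (map (\<lambda>f. mpoly_value f (\<lambda>i. concat qs ! i) \<ge> 0) fs)"

text \<open>The tuples \<open>(p\<^bsub>i\<^sub>1\<^esub>, \<dots>, p\<^bsub>i\<^sub>k\<^esub>)\<close> with \<open>i\<^sub>1 < \<dots> < i\<^sub>k\<close>.\<close>

definition increasing_tuples :: "nat \<Rightarrow> 'a list \<Rightarrow> 'a list set" where
  "increasing_tuples k P =
     {map ((!) P) js | js. length js = k \<and> sorted_wrt (<) js \<and> set js \<subseteq> {..<length P}}"

text \<open>
  \<open>E\<close> is the \<open>k\<close>-ary relation on the point sequence \<open>P\<close> in \<open>\<real>\<^sup>d\<close>, of complexity at most \<open>t\<close>,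
  that is described by the polynomials \<open>fs\<close> and the Boolean function \<open>\<Phi>\<close>.
\<close>

definition semialg_described_by ::
  "nat \<Rightarrow> nat \<Rightarrow> nat \<Rightarrow> point list \<Rightarrow> point set set \<Rightarrow>
     real_mpoly list \<Rightarrow> (bool list \<Rightarrow> bool) \<Rightarrow> bool" where
  "semialg_described_by d t k P E fs \<Phi> \<longleftrightarrow>
     set P \<subseteq> points d \<and> E \<subseteq> nsets (set P) k \<and>
     length fs = t \<and> set fs \<subseteq> mpolys (k * d) t \<and>
     (\<forall>qs\<in>increasing_tuples k P. set qs \<in> E \<longleftrightarrow> semialg_cond fs \<Phi> qs)"

definition semialg_relation ::
  "nat \<Rightarrow> nat \<Rightarrow> nat \<Rightarrow> point list \<Rightarrow> point set set \<Rightarrow> bool" where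
  "semialg_relation d t k P E \<longleftrightarrow> (\<exists>fs \<Phi>. semialg_described_by d t k P E fs \<Phi>)"

definition symmetric_semialg_relation ::
  "nat \<Rightarrow> nat \<Rightarrow> nat \<Rightarrow> point list \<Rightarrow> point set set \<Rightarrow> bool" where
  "symmetric_semialg_relation d t k P E \<longleftrightarrow>
     (\<exists>fs \<Phi>. semialg_described_by d t k P E fs \<Phi> \<and>
        (\<forall>qs\<in>increasing_tuples k P. \<forall>rs. mset rs = mset qs \<longrightarrow>
           (semialg_cond fs \<Phi> qs \<longleftrightarrow> semialg_cond fs \<Phi> rs)))"

text \<open>
  An \<open>N\<close>-element point set is presented by a listing \<open>P\<close> of its points without repetition.
\<close>

definition semialg_ramsey_prop ::
  "nat \<Rightarrow> nat \<Rightarrow> nat \<Rightarrow> nat \<Rightarrow> nat \<Rightarrow> nat \<Rightarrow> bool" where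
  "semialg_ramsey_prop d t k s n N \<longleftrightarrow>
     (\<forall>P E. length P = N \<and> distinct P \<and> symmetric_semialg_relation d t k P E \<longrightarrow>
        (\<exists>S\<subseteq>set P. card S = s \<and> nsets S k \<subseteq> E) \<or>
        (\<exists>T\<subseteq>set P. card T = n \<and> nsets T k \<inter> E = {}))"

text \<open>
  \<open>R\<^sub>k\<^bsup>d,t\<^esup>(s,n)\<close>, with value \<open>\<infinity>\<close> if no \<open>N\<close> had the Ramsey property; thus a real upper bound
  includes the existence of such an \<open>N\<close>.
\<close>

definition semialg_ramsey :: "nat \<Rightarrow> nat \<Rightarrow> nat \<Rightarrow> nat \<Rightarrow> nat \<Rightarrow> enat" where
  "semialg_ramsey d t k s n = (INF N\<in>{N. semialg_ramsey_prop d t k s n N}. enat N)"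

end

theory Submission
  imports Defs "HOL-Real_Asymp.Real_Asymp"
begin

text \<open>
  In monomial coordinates every condition \<open>f(p, p', q) \<ge> 0\<close> is linear in \<open>q\<close>, so an elementary
  cutting lemma for linear forms applies: a subset of the candidates \<open>q\<close> of only polynomially
  smaller size is not separated by most of the pairs \<open>(p, p')\<close>.  The rest is combinatorics.  By
  induction on \<open>s\<close> one finds, in a set of \<open>2\<^sup>a\<close> points without an \<open>s\<close>-clique, \<open>m\<close> parts of size
  about \<open>2\<close> to the power \<open>a / log m\<close> such that no triple meeting at least two of the parts is an
  edge: make the triples of types 1+1+1 and 2+1 homogeneous, choose \<open>m\<close> parts by an Erdos-Rado
  argument on representatives, and then thin out each part with respect to the \<open>m\<close> graphs that the
  representatives of the other parts induce on it.  These graphs contain no large cliques by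
  induction, and a common independent set is found by splitting the part recursively into pairs that
  are homogeneous for all \<open>m\<close> graphs, as in a cograph.  Iterating with \<open>log m\<close> about
  \<open>sqrt (log n * log (log n))\<close> multiplies the size of the independent set by \<open>m\<close> in each round at
  the cost of a factor \<open>log m\<close> in the exponent.
\<close>

section \<open>Cuttings for linear forms\<close>

text \<open>Sizes are powers of two and all accounting is done in exponents, called bits below.
  Making all but a proportion \<open>2^-e\<close> of a family constant costs
  \<open>C * (e + 1)\<close> bits, however large the family is. The obstacle is to thin one part
  against m graphs at once. Treating the graphs one after another would divide the exponent by a
  constant for each graph, a loss exponential in m. A split that is homogeneous for all of them
  costs only O(log m) bits, and k nested splits give sets, one per graph and one avoiding all
  graphs, whose sizes have product at least \<open>2^k\<close>. Cliques of size at most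
  \<open>2^l\<close> then leave \<open>2^(k - l * m)\<close> for the last set: the exponent is
  divided by O(log m) and reduced by \<open>l * m\<close>. The balance explains the bound. With g =
  log m there are about log n / g rounds, which multiply the required exponent by O(g)^(log n / g) =
  2^(O(log n log log n / g)); the innermost round needs an exponent m^(O(s)) = 2^(O(g)) for the
  Erdos-Rado argument. Both are equal in order for g = sqrt(log n log log n).\<close>

lemma pigeonhole_fibre:
  assumes "finite A" and "f ` A \<subseteq> B" and "finite B" and "card B \<le> N"
  obtains y where "card A \<le> N * card {x \<in> A. f x = y}"
proof (rule ccontr)
  assume neg: "\<not> thesis"
  then have lt: "N * card {x \<in> A. f x = y} < card A" for y
    using that not_le by blast
  have "A \<noteq> {}" using lt by fastforce
  then have Bne: "B \<noteq> {}" using assms(2) by blast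
  have "card A = (\<Sum>y\<in>B. card {x \<in> A. f x = y})"
    using card_eq_sum[of A] sum.group[OF assms(1,3,2), of "\<lambda>_. 1::nat"] by simp
  then have "N * card A = (\<Sum>y\<in>B. N * card {x \<in> A. f x = y})"
    by (simp add: sum_distrib_left)
  also have "\<dots> < (\<Sum>y\<in>B. card A)"
    by (rule sum_strict_mono) (use lt Bne assms in auto)
  also have "\<dots> \<le> N * card A" using assms(4) by simp
  finally show False by simp
qed

lemma less_add_if_div_eq:
  fixes a b n :: nat
  assumes "a div n = b div n" and "0 < n"
  shows "a < b + n"
proof -
  have "a < a div n * n + n" using dividend_less_div_times[OF assms(2), of a] by simp
  also have "\<dots> \<le> b + n" by (simp add: assms(1))
  finally show ?thesis .
qed

text \<open>Once the thresholds \<open>k x\<close> agree up to \<open>card H / 2 ^ f\<close>, an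
  index \<open>h\<close> can cross its threshold inside \<open>A'\<close> only if its rank drifts a
  lot, which the bound on the sum of the drifts makes rare, or if its rank at one fixed point lies
  close to the threshold there, which injectivity of the ranks makes rare.\<close>

lemma threshold_step:
  fixes rk :: "'x \<Rightarrow> 'h \<Rightarrow> nat" and k :: "'x \<Rightarrow> nat" and \<Delta> :: "'h \<Rightarrow> nat"
  assumes fin: "finite A" "finite H"
    and inj: "\<And>x. x \<in> A \<Longrightarrow> inj_on (rk x) H"
    and kle: "\<And>x. x \<in> A \<Longrightarrow> k x \<le> card H"
    and \<Delta>: "\<And>x z h. x \<in> A \<Longrightarrow> z \<in> A \<Longrightarrow> h \<in> H \<Longrightarrow> rk x h \<le> rk z h + \<Delta> h"
    and sum\<Delta>: "(\<Sum>h\<in>H. \<Delta> h) * 2 ^ (2 * f) \<le> card H * card H"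
  obtains A' where "A' \<subseteq> A" "card A \<le> 2 ^ f * card A'"
    "card {h \<in> H. \<exists>x\<in>A'. \<exists>z\<in>A'. rk x h < k x \<and> \<not> rk z h < k z} * 2 ^ f \<le> 5 * card H"
proof (cases "A = {}")
  case True
  then show ?thesis using that[of "{}"] by simp
next
  case False
  define N where "N = card H"
  \<comment> \<open>The thresholds are sorted into \<open>2 ^ f\<close> buckets. Dividing by
    \<open>N + 1\<close> keeps the extreme value \<open>k x = N\<close> below index
    \<open>2 ^ f\<close> and is harmless for empty \<open>H\<close>.\<close>
  define bu where "bu x = k x * 2 ^ f div (N + 1)" for x
  have "bu ` A \<subseteq> {..<2 ^ f}"
  proof
    fix y assume "y \<in> bu ` A"
    then obtain x where x: "x \<in> A" "y = bu x" by auto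
    have "k x * 2 ^ f < (N + 1) * 2 ^ f" using kle[OF x(1)] by (intro mult_less_mono1) (auto simp: N_def)
    then have "bu x < 2 ^ f" unfolding bu_def using less_mult_imp_div_less by (simp add: mult.commute)
    then show "y \<in> {..<2 ^ f}" using x by simp
  qed
  then obtain y where y: "card A \<le> 2 ^ f * card {x \<in> A. bu x = y}"
    using pigeonhole_fibre[OF fin(1), of bu "{..<2 ^ f}" "2 ^ f"] by auto
  define A' where "A' = {x \<in> A. bu x = y}"
  have A'ne: "A' \<noteq> {}" using y False fin A'_def by fastforce
  then obtain x0 where x0: "x0 \<in> A'" by auto
  have sub: "A' \<subseteq> A" by (auto simp: A'_def)
  define w where "w = N div 2 ^ f"
  have near: "k x \<le> k z + w" if "x \<in> A'" "z \<in> A'" for x z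
  proof -
    have "k x * 2 ^ f div (N + 1) = k z * 2 ^ f div (N + 1)" using that by (simp add: A'_def bu_def)
    then have "k x * 2 ^ f < k z * 2 ^ f + (N + 1)" by (rule less_add_if_div_eq) simp
    then have "(k x - k z) * 2 ^ f \<le> N" by (simp add: diff_mult_distrib)
    then have "k x - k z \<le> w" unfolding w_def by (simp add: less_eq_div_iff_mult_less_eq)
    then show ?thesis by simp
  qed
  \<comment> \<open>Markov's inequality: the average drift is at most \<open>N / 2^(2 * f)\<close>,
    so at most \<open>N / 2^f\<close> indices drift by more than \<open>N / 2^f\<close>.\<close>
  define big where "big = {h \<in> H. N < \<Delta> h * 2 ^ f}"
  have finb: "finite big" using fin by (simp add: big_def)
  have bigc: "card big * 2 ^ f \<le> N"
  proof (cases "N = 0")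
    case True
    then show ?thesis using fin by (auto simp: N_def big_def)
  next
    case False
    have "card big * N \<le> (\<Sum>h\<in>big. \<Delta> h * 2 ^ f)"
      using sum_mono[of big "\<lambda>_. N" "\<lambda>h. \<Delta> h * 2 ^ f"] by (auto simp: big_def)
    also have "\<dots> \<le> (\<Sum>h\<in>H. \<Delta> h * 2 ^ f)"
      by (rule sum_mono2) (use fin in \<open>auto simp: big_def\<close>)
    finally have "card big * N * 2 ^ f \<le> (\<Sum>h\<in>H. \<Delta> h * 2 ^ f) * 2 ^ f" by (rule mult_le_mono1)
    also have "\<dots> = (\<Sum>h\<in>H. \<Delta> h) * 2 ^ (2 * f)"
      by (simp add: sum_distrib_right mult_2 power_add mult.assoc)
    finally have "card big * N * 2 ^ f \<le> (\<Sum>h\<in>H. \<Delta> h) * 2 ^ (2 * f)" .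
    then have "card big * N * 2 ^ f \<le> N * N" using sum\<Delta> unfolding N_def by (rule le_trans)
    then have "N * (card big * 2 ^ f) \<le> N * N" by (simp only: ac_simps)
    then show ?thesis using False by (simp only: mult_le_cancel1)
  qed
  \<comment> \<open>One \<open>w\<close> accounts for the drift between the crossing point and
    \<open>x0\<close>, another for the difference of their thresholds. The window then contains
    \<open>4 * w\<close> ranks; together with \<open>big\<close> this gives the factor 5.\<close>
  define \<delta> where "\<delta> = 2 * w"
  define cr where "cr = {h \<in> H. \<exists>x\<in>A'. \<exists>z\<in>A'. rk x h < k x \<and> \<not> rk z h < k z}"
  have "rk x0 ` (cr - big) \<subseteq> {k x0 - \<delta>..<k x0 + \<delta>}"
  proof
    fix r assume "r \<in> rk x0 ` (cr - big)"
    then obtain h where h: "h \<in> cr" "h \<notin> big" "r = rk x0 h" by auto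
    then obtain x z where xz: "x \<in> A'" "z \<in> A'" "rk x h < k x" "k z \<le> rk z h" "h \<in> H"
      by (auto simp: cr_def not_less)
    have "\<Delta> h \<le> w" using h xz by (auto simp: big_def w_def less_eq_div_iff_mult_less_eq not_less)
    moreover have "rk x0 h \<le> rk x h + \<Delta> h" "rk z h \<le> rk x0 h + \<Delta> h"
      using \<Delta>[of x0 x h] \<Delta>[of z x0 h] sub xz x0 by auto
    ultimately show "r \<in> {k x0 - \<delta>..<k x0 + \<delta>}"
      using near[OF xz(1) x0] near[OF x0 xz(2)] xz h(3) by (auto simp: \<delta>_def)
  qed
  then have "card (rk x0 ` (cr - big)) \<le> card {k x0 - \<delta>..<k x0 + \<delta>}"
    by (intro card_mono) auto
  moreover have "inj_on (rk x0) (cr - big)"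
    by (rule inj_on_subset[OF inj]) (use x0 sub in \<open>auto simp: cr_def\<close>)
  ultimately have "card (cr - big) \<le> 2 * \<delta>" by (simp add: card_image)
  moreover have "card cr \<le> card (cr - big) + card big"
    using diff_card_le_card_Diff[OF finb, of cr] by simp
  ultimately have "card cr * 2 ^ f \<le> (4 * w) * 2 ^ f + card big * 2 ^ f"
    unfolding \<delta>_def add_mult_distrib[symmetric] by (intro mult_le_mono1) simp
  also have "\<dots> \<le> 4 * N + N"
    unfolding w_def mult.assoc by (intro add_mono bigc mult_le_mono2 div_times_less_eq_dividend)
  finally have "card cr * 2 ^ f \<le> 5 * card H" by (simp add: N_def)
  then show ?thesis using that[of A'] sub y by (simp add: A'_def cr_def)
qed

text \<open>The three-valued sign makes the notion invariant under multiplication by any nonzero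
  constant, negative ones included; the predicate \<open>g x \<ge> 0\<close> alone would not
  be.\<close>

definition changes_sign :: "('x \<Rightarrow> real) \<Rightarrow> 'x set \<Rightarrow> bool" where
  "changes_sign g A \<longleftrightarrow> (\<exists>x\<in>A. \<exists>z\<in>A. sgn (g x) \<noteq> sgn (g z))"

lemma changes_sign_mono: "changes_sign g A \<Longrightarrow> A \<subseteq> B \<Longrightarrow> changes_sign g B"
  by (auto simp: changes_sign_def)

lemma changes_sign_mult:
  "c \<noteq> 0 \<Longrightarrow> changes_sign (\<lambda>x. c * g x) A \<longleftrightarrow> changes_sign g A"
  by (simp add: changes_sign_def sgn_mult sgn_0_0)

text \<open>The sign is determined by one weak and one strict threshold at zero, so a sign change
  can be detected by two threshold arguments.\<close>

lemma sgn_neq_cases: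
  fixes a b :: real
  assumes "sgn a \<noteq> sgn b"
  shows "(0 \<le> a \<and> \<not> 0 \<le> b) \<or> (0 \<le> b \<and> \<not> 0 \<le> a) \<or> (0 < a \<and> \<not> 0 < b) \<or> (0 < b \<and> \<not> 0 < a)"
  using assms by (auto simp: sgn_if split: if_splits)

text \<open>Ranks are taken with respect to the order of the values \<^term>\<open>g h p\<close>, ties being broken by
  the index \<^term>\<open>h\<close>.\<close>

lemma order_cutting:
  fixes g :: "nat \<Rightarrow> 'x \<Rightarrow> real" and y :: "'x \<Rightarrow> real"
  assumes fin: "finite A" "finite H"
    and pairs: "card {ij \<in> H \<times> H. changes_sign (\<lambda>p. g (fst ij) p - g (snd ij) p) A} * 2 ^ (2 * f)
      \<le> card H * card H"
  obtains A' where "A' \<subseteq> A" "card A \<le> 2 ^ (2 * f) * card A'"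
    "card {h \<in> H. changes_sign (\<lambda>p. y p - g h p) A'} * 2 ^ f \<le> 10 * card H"
proof -
  define below where "below p h h' \<longleftrightarrow> g h' p < g h p \<or> (g h' p = g h p \<and> h' < h)" for p h h'
  define rk where "rk p h = card {h' \<in> H. below p h h'}" for p h
  define \<Delta> where "\<Delta> h = card {h' \<in> H. changes_sign (\<lambda>p. g h p - g h' p) A}" for h
  have mono: "rk p h < rk p h'" if "h \<in> H" "below p h' h" for p h h'
  proof -
    have "h \<in> {h'' \<in> H. below p h' h''}" "h \<notin> {h'' \<in> H. below p h h''}"
      using that by (auto simp: below_def)
    moreover have "{h'' \<in> H. below p h h''} \<subseteq> {h'' \<in> H. below p h' h''}"
      using that unfolding below_def by force
    ultimately show ?thesis unfolding rk_def using fin(2) by (intro psubset_card_mono) auto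
  qed
  have inj: "inj_on (rk p) H" for p
  proof (rule inj_onI, rule ccontr)
    fix h h' assume *: "h \<in> H" "h' \<in> H" "rk p h = rk p h'" "h \<noteq> h'"
    then have "below p h h' \<or> below p h' h" by (auto simp: below_def)
    then show False using mono[of h p h'] mono[of h' p h] * by auto
  qed
  \<comment> \<open>Only an index \<open>h'\<close> that changes its order relative to
    \<open>h\<close> can affect the rank of \<open>h\<close>, and each such \<open>h'\<close> is
    counted by \<open>\<Delta> h\<close>.\<close>
  have \<Delta>: "rk p h \<le> rk q h + \<Delta> h" if "p \<in> A" "q \<in> A" "h \<in> H" for p q h
  proof -
    have "{h' \<in> H. below p h h'}
      \<subseteq> {h' \<in> H. below q h h'} \<union> {h' \<in> H. changes_sign (\<lambda>p. g h p - g h' p) A}"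
    proof (rule subsetI, rule UnCI)
      fix h' assume "h' \<in> {h' \<in> H. below p h h'}"
        "h' \<notin> {h' \<in> H. changes_sign (\<lambda>p. g h p - g h' p) A}"
      then have h': "h' \<in> H" "below p h h'" "\<not> changes_sign (\<lambda>p. g h p - g h' p) A" by auto
      then have "sgn (g h p - g h' p) = sgn (g h q - g h' q)"
        using that unfolding changes_sign_def by blast
      then have "g h' p < g h p \<longleftrightarrow> g h' q < g h q" "g h' p = g h p \<longleftrightarrow> g h' q = g h q"
      by (simp_all add: sgn_if split: if_splits)
    then show "h' \<in> {h' \<in> H. below q h h'}" using h'(1,2) by (simp add: below_def)
    qed
    then have "rk p h \<le> card ({h' \<in> H. below q h h'} \<union> {h' \<in> H. changes_sign (\<lambda>p. g h p - g h' p) A})"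
      unfolding rk_def by (rule card_mono[rotated]) (use fin in auto)
    also have "\<dots> \<le> rk q h + \<Delta> h" unfolding rk_def \<Delta>_def by (rule card_Un_le)
    finally show ?thesis .
  qed
  have "{ij \<in> H \<times> H. changes_sign (\<lambda>p. g (fst ij) p - g (snd ij) p) A}
      = (SIGMA h:H. {h' \<in> H. changes_sign (\<lambda>p. g h p - g h' p) A})" by auto
  then have sum\<Delta>: "(\<Sum>h\<in>H. \<Delta> h) * 2 ^ (2 * f) \<le> card H * card H"
    using pairs fin by (simp add: \<Delta>_def)
  \<comment> \<open>A set closed downwards in the order at \<open>p\<close> consists of exactly the
    \<open>card D\<close> lowest ranks, so membership becomes a rank threshold.\<close>
  have down: "h \<in> D \<longleftrightarrow> rk p h < card D"
    if "D \<subseteq> H" "h \<in> H" "\<And>i j. i \<in> D \<Longrightarrow> j \<in> H \<Longrightarrow> below p i j \<Longrightarrow> j \<in> D" for D p h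
  proof
    assume "h \<in> D"
    then have "{h' \<in> H. below p h h'} \<subset> D" using that by (auto simp: below_def)
    then show "rk p h < card D" unfolding rk_def
      using that(1) fin(2) by (meson finite_subset psubset_card_mono)
  next
    assume lt: "rk p h < card D"
    show "h \<in> D"
    proof (rule ccontr)
      assume "h \<notin> D"
      have "D \<subseteq> {h' \<in> H. below p h h'}"
      proof
        fix i assume i: "i \<in> D"
        then have "\<not> below p i h" "i \<noteq> h" using that \<open>h \<notin> D\<close> by auto
        then show "i \<in> {h' \<in> H. below p h h'}" using i that(1) by (auto simp: below_def)
      qed
      then have "card D \<le> rk p h" unfolding rk_def by (rule card_mono[rotated]) (use fin in auto)
      then show False using lt by simp
    qed
  qed
  \<comment> \<open>The weak and the strict comparison with \<open>y p\<close> are both initial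
    segments. Each costs \<open>f\<close> bits and a proportion \<open>5 / 2^f\<close> of the
    indices, whence \<open>2 * f\<close> and 10.\<close>
  define D1 where "D1 p = {h \<in> H. g h p \<le> y p}" for p
  define D2 where "D2 p = {h \<in> H. g h p < y p}" for p
  have cardD: "card (D1 p) \<le> card H" "card (D2 p) \<le> card H" for p
    by (auto intro!: card_mono fin simp: D1_def D2_def)
  have D1: "g h p \<le> y p \<longleftrightarrow> rk p h < card (D1 p)" if "h \<in> H" for p h
  proof -
    have "j \<in> D1 p" if "i \<in> D1 p" "j \<in> H" "below p i j" for i j
      using that by (auto simp: D1_def below_def)
    then have "h \<in> D1 p \<longleftrightarrow> rk p h < card (D1 p)"
      using that by (intro down) (auto simp: D1_def)
    then show ?thesis using that by (simp add: D1_def)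
  qed
  have D2: "g h p < y p \<longleftrightarrow> rk p h < card (D2 p)" if "h \<in> H" for p h
  proof -
    have "j \<in> D2 p" if "i \<in> D2 p" "j \<in> H" "below p i j" for i j
      using that by (auto simp: D2_def below_def)
    then have "h \<in> D2 p \<longleftrightarrow> rk p h < card (D2 p)"
      using that by (intro down) (auto simp: D2_def)
    then show ?thesis using that by (simp add: D2_def)
  qed
  obtain B where B: "B \<subseteq> A" "card A \<le> 2 ^ f * card B"
    "card {h \<in> H. \<exists>x\<in>B. \<exists>z\<in>B. rk x h < card (D1 x) \<and> \<not> rk z h < card (D1 z)} * 2 ^ f \<le> 5 * card H"
    by (rule threshold_step[OF fin, of rk "\<lambda>p. card (D1 p)" \<Delta> f])
      (use inj cardD \<Delta> sum\<Delta> in auto)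
  obtain A' where A': "A' \<subseteq> B" "card B \<le> 2 ^ f * card A'"
    "card {h \<in> H. \<exists>x\<in>A'. \<exists>z\<in>A'. rk x h < card (D2 x) \<and> \<not> rk z h < card (D2 z)} * 2 ^ f \<le> 5 * card H"
    by (rule threshold_step[OF finite_subset[OF B(1) fin(1)] fin(2), of rk "\<lambda>p. card (D2 p)" \<Delta> f])
      (use inj cardD \<Delta> sum\<Delta> subsetD[OF B(1)] in auto)
  let ?B1 = "{h \<in> H. \<exists>x\<in>B. \<exists>z\<in>B. rk x h < card (D1 x) \<and> \<not> rk z h < card (D1 z)}"
  let ?B2 = "{h \<in> H. \<exists>x\<in>A'. \<exists>z\<in>A'. rk x h < card (D2 x) \<and> \<not> rk z h < card (D2 z)}"
  have "{h \<in> H. changes_sign (\<lambda>p. y p - g h p) A'} \<subseteq> ?B1 \<union> ?B2"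
  proof
    fix h assume "h \<in> {h \<in> H. changes_sign (\<lambda>p. y p - g h p) A'}"
    then obtain p q where pq: "h \<in> H" "p \<in> A'" "q \<in> A'" "sgn (y p - g h p) \<noteq> sgn (y q - g h q)"
      by (auto simp: changes_sign_def)
    then have "(g h p \<le> y p \<and> \<not> g h q \<le> y q) \<or> (g h q \<le> y q \<and> \<not> g h p \<le> y p)
       \<or> (g h p < y p \<and> \<not> g h q < y q) \<or> (g h q < y q \<and> \<not> g h p < y p)"
      using sgn_neq_cases[OF pq(4)] by simp
    then show "h \<in> ?B1 \<union> ?B2"
      using pq(1-3) A'(1) unfolding D1[OF pq(1)] D2[OF pq(1)] by blast
  qed
  then have "card {h \<in> H. changes_sign (\<lambda>p. y p - g h p) A'} \<le> card (?B1 \<union> ?B2)"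
    by (intro card_mono) (use fin in auto)
  also have "\<dots> \<le> card ?B1 + card ?B2" by (rule card_Un_le)
  finally have "card {h \<in> H. changes_sign (\<lambda>p. y p - g h p) A'} * 2 ^ f
    \<le> (card ?B1 + card ?B2) * 2 ^ f" by (rule mult_le_mono1)
  also have "\<dots> \<le> 10 * card H" using B(3) A'(3) by (simp add: add_mult_distrib)
  finally have "card {h \<in> H. changes_sign (\<lambda>p. y p - g h p) A'} * 2 ^ f \<le> 10 * card H" .
  moreover have "card A \<le> 2 ^ (2 * f) * card A'"
  proof -
    have "card A \<le> 2 ^ f * (2 ^ f * card A')" using B(2) A'(2) by (meson le_trans mult_le_mono2)
    then show ?thesis by (simp add: mult_2 power_add mult.assoc)
  qed
  ultimately show ?thesis using that[of A'] A'(1) B(1) by blast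
qed

section \<open>Linear cuttings by induction on the number of variables\<close>

definition lin :: "nat \<Rightarrow> (nat \<Rightarrow> real) \<Rightarrow> (nat \<Rightarrow> real) \<Rightarrow> real" where
  "lin D a x = (\<Sum>i<D. a i * x i)"

definition lin_cutting :: "('x \<Rightarrow> nat \<Rightarrow> real) \<Rightarrow> nat \<Rightarrow> nat \<Rightarrow> bool" where
  "lin_cutting x D C \<longleftrightarrow> (\<forall>n a X (e::nat). finite X \<longrightarrow>
     (\<exists>A\<subseteq>X. card X \<le> 2 ^ (C * (e + 1)) * card A \<and>
        card {i \<in> {..<n::nat}. changes_sign (\<lambda>p. lin D (a i) (x p)) A} * 2 ^ e \<le> n))"

text \<open>The definition indexes the forms by an initial segment of the naturals, so that it
  quantifies over one fixed type; the induction on the dimension needs forms indexed by pairs. Forms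
  are counted with multiplicity in both versions.\<close>

lemma lin_cuttingE:
  assumes cut: "lin_cutting x D C" and fin: "finite X" "finite I"
  obtains A where "A \<subseteq> X" "card X \<le> 2 ^ (C * (e + 1)) * card A"
    "card {i \<in> I. changes_sign (\<lambda>p. lin D (a i) (x p)) A} * 2 ^ e \<le> card I"
proof -
  obtain h where h: "bij_betw h {..<card I} I"
    using ex_bij_betw_nat_finite[OF fin(2)] by (auto simp: atLeast0LessThan)
  obtain A where A: "A \<subseteq> X" "card X \<le> 2 ^ (C * (e + 1)) * card A"
    "card {i \<in> {..<card I}. changes_sign (\<lambda>p. lin D (a (h i)) (x p)) A} * 2 ^ e \<le> card I"
    using cut[unfolded lin_cutting_def, rule_format, OF fin(1), of e "card I" "\<lambda>i. a (h i)"] by blast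
  have "{i \<in> I. changes_sign (\<lambda>p. lin D (a i) (x p)) A}
      = h ` {i \<in> {..<card I}. changes_sign (\<lambda>p. lin D (a (h i)) (x p)) A}"
    using bij_betw_imp_surj_on[OF h] by auto
  then have "card {i \<in> I. changes_sign (\<lambda>p. lin D (a i) (x p)) A}
     \<le> card {i \<in> {..<card I}. changes_sign (\<lambda>p. lin D (a (h i)) (x p)) A}"
    by (simp add: card_image_le)
  then show ?thesis using that[OF A(1,2)] A(3) by (meson le_trans mult_le_mono1)
qed

text \<open>A form with nonzero last coefficient is a multiple of
  \<open>x p D - lin D (b i) (x p)\<close>. Differences of two such \<open>b i\<close> are again
  forms in \<open>D\<close> variables, so the hypothesis fixes the relative order of most pairs of
  values \<open>lin D (b i) (x p)\<close>, and \<open>order_cutting\<close> then locates the last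
  coordinate among them. Forms with zero last coefficient fall under the hypothesis
  directly.\<close>

lemma lin_cutting_Suc:
  assumes cut: "lin_cutting x D C"
  shows "lin_cutting x (Suc D) (10 * C + 8)"
  unfolding lin_cutting_def
proof (intro allI impI)
  fix n e :: nat and a :: "nat \<Rightarrow> nat \<Rightarrow> real" and X :: "'a set"
  assume finX: "finite X"
  define Z where "Z = {i. i < n \<and> a i D = 0}"
  define H where "H = {i. i < n \<and> a i D \<noteq> 0}"
  \<comment> \<open>The extra 4 absorbs the factor 10 of \<open>order_cutting\<close>, as
    \<open>10 \<le> 2^4\<close>.\<close>
  define f where "f = e + 4"
  have fin: "finite Z" "finite H" by (auto simp: Z_def H_def)
  have cardn: "card Z + card H = n"
    using card_Un_disjoint[OF fin] by (auto simp: Z_def H_def Un_def disjoint_iff)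
      (metis (no_types, lifting) Collect_cong card_Collect_less_nat)
  define b where "b i j = - a i j / a i D" for i j
  obtain A1 where A1: "A1 \<subseteq> X" "card X \<le> 2 ^ (C * (e + 1)) * card A1"
    "card {i \<in> Z. changes_sign (\<lambda>p. lin D (a i) (x p)) A1} * 2 ^ e \<le> card Z"
    using lin_cuttingE[OF cut finX fin(1), of e a] by blast
  have finA1: "finite A1" using A1(1) finX finite_subset by blast
  obtain A2 where A2: "A2 \<subseteq> A1" "card A1 \<le> 2 ^ (C * (2 * f + 1)) * card A2"
    "card {ij \<in> H \<times> H. changes_sign (\<lambda>p. lin D (\<lambda>l. b (fst ij) l - b (snd ij) l) (x p)) A2} * 2 ^ (2 * f)
       \<le> card (H \<times> H)"
    using lin_cuttingE[OF cut finA1 finite_cartesian_product[OF fin(2,2)],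
        of "2 * f" "\<lambda>ij l. b (fst ij) l - b (snd ij) l"] by blast
  have finA2: "finite A2" using A2(1) finA1 finite_subset by blast
  have lindiff: "lin D (\<lambda>l. u l - v l) w = lin D u w - lin D v w" for u v w
    by (simp add: lin_def sum_subtractf left_diff_distrib)
  obtain A where A: "A \<subseteq> A2" "card A2 \<le> 2 ^ (2 * f) * card A"
    "card {h \<in> H. changes_sign (\<lambda>p. x p D - lin D (b h) (x p)) A} * 2 ^ f \<le> 10 * card H"
    using order_cutting[OF finA2 fin(2), of "\<lambda>h p. lin D (b h) (x p)" f "\<lambda>p. x p D"] A2(3)
    unfolding lindiff card_cartesian_product by blast
  have Z: "changes_sign (\<lambda>p. lin (Suc D) (a i) (x p)) A \<longleftrightarrow> changes_sign (\<lambda>p. lin D (a i) (x p)) A"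
    if "i \<in> Z" for i using that by (simp add: lin_def Z_def)
  have H: "changes_sign (\<lambda>p. lin (Suc D) (a i) (x p)) A
      \<longleftrightarrow> changes_sign (\<lambda>p. x p D - lin D (b i) (x p)) A" if "i \<in> H" for i
  proof -
    have nz: "a i D \<noteq> 0" using that by (simp add: H_def)
    then have "a i D * lin D (b i) (x p) = - lin D (a i) (x p)" for p
      unfolding lin_def b_def sum_distrib_left sum_negf[symmetric] by (intro sum.cong) auto
    then have "lin (Suc D) (a i) (x p) = a i D * (x p D - lin D (b i) (x p))" for p
      by (simp add: lin_def right_diff_distrib)
    then show ?thesis using changes_sign_mult[OF nz] by simp
  qed
  let ?S = "{i \<in> {..<n}. changes_sign (\<lambda>p. lin (Suc D) (a i) (x p)) A}"
  let ?S1 = "{i \<in> Z. changes_sign (\<lambda>p. lin D (a i) (x p)) A1}"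
  let ?S2 = "{h \<in> H. changes_sign (\<lambda>p. x p D - lin D (b h) (x p)) A}"
  have "?S \<subseteq> ?S1 \<union> ?S2"
  proof
    fix i assume i: "i \<in> ?S"
    show "i \<in> ?S1 \<union> ?S2"
    proof (cases "a i D = 0")
      case True
      then have "i \<in> Z" using i by (simp add: Z_def)
      then show ?thesis using i Z changes_sign_mono A(1) A2(1) by blast
    next
      case False
      then have "i \<in> H" using i by (simp add: H_def)
      then show ?thesis using i H by blast
    qed
  qed
  then have "card ?S \<le> card (?S1 \<union> ?S2)" by (intro card_mono) (use fin in auto)
  also have "\<dots> \<le> card ?S1 + card ?S2" by (rule card_Un_le)
  finally have "card ?S * 2 ^ e \<le> (card ?S1 + card ?S2) * 2 ^ e" by (rule mult_le_mono1)
  also have "\<dots> = card ?S1 * 2 ^ e + card ?S2 * 2 ^ e" by (rule add_mult_distrib)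
  also have "\<dots> \<le> card Z + card H"
  proof (rule add_mono[OF A1(3)])
    have "card ?S2 * 2 ^ e * 16 \<le> 10 * card H" using A(3) by (simp add: f_def power_add mult.assoc)
    then show "card ?S2 * 2 ^ e \<le> card H" by linarith
  qed
  finally have "card ?S * 2 ^ e \<le> n" using cardn by simp
  moreover have "card X \<le> 2 ^ ((10 * C + 8) * (e + 1)) * card A"
  proof -
    have "card X \<le> 2 ^ (C * (e + 1)) * (2 ^ (C * (2 * f + 1)) * (2 ^ (2 * f) * card A))"
      using A1(2) A2(2) A(2) by (meson le_trans mult_le_mono2)
    also have "\<dots> = 2 ^ (C * (e + 1) + C * (2 * f + 1) + 2 * f) * card A"
      by (simp only: power_add mult.assoc)
    also have "\<dots> \<le> 2 ^ ((10 * C + 8) * (e + 1)) * card A"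
    proof (intro mult_le_mono1 power_increasing)
      have "C * (2 * f + 1) \<le> C * (9 * (e + 1))" by (intro mult_le_mono2) (simp add: f_def)
      then show "C * (e + 1) + C * (2 * f + 1) + 2 * f \<le> (10 * C + 8) * (e + 1)"
        by (simp add: f_def algebra_simps)
    qed simp
    finally show ?thesis .
  qed
  ultimately show "\<exists>A\<subseteq>X. card X \<le> 2 ^ ((10 * C + 8) * (e + 1)) * card A \<and>
      card {i \<in> {..<n}. changes_sign (\<lambda>p. lin (Suc D) (a i) (x p)) A} * 2 ^ e \<le> n"
    using A(1) A2(1) A1(1) by blast
qed

lemma ex_lin_cutting: "\<exists>C. lin_cutting x D C"
proof (induction D)
  case 0
  have "lin_cutting x 0 0" by (auto simp: lin_cutting_def lin_def changes_sign_def)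
  then show ?case ..
next
  case (Suc D)
  then show ?case using lin_cutting_Suc by blast
qed

section \<open>Semi-algebraic relations\<close>

text \<open>All that the combinatorial part uses of semi-algebraicity. The constant \<open>C\<close>
  is a parameter because the bounds must be uniform over all relations of given dimension and
  complexity. Symmetry is asked only at distinct points, where the Boolean condition is known to be
  symmetric, whereas cutting also covers pairs \<open>(p, p)\<close> and points occurring in
  \<open>X\<close>.\<close>

locale cuttable_relation =
  fixes C :: nat and U :: "'a set" and R :: "'a \<Rightarrow> 'a \<Rightarrow> 'a \<Rightarrow> bool"
  assumes cutting: "\<And>F X e. \<lbrakk>F \<subseteq> U \<times> U; finite F; X \<subseteq> U; finite X\<rbrakk> \<Longrightarrow>
      \<exists>A\<subseteq>X. card X \<le> 2 ^ (C * (e + 1)) * card A \<and>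
        card {f \<in> F. \<exists>x\<in>A. \<exists>z\<in>A. R (fst f) (snd f) x \<noteq> R (fst f) (snd f) z} * 2 ^ e \<le> card F"
    and swap12: "\<And>p q r. \<lbrakk>p \<in> U; q \<in> U; r \<in> U; p \<noteq> q; p \<noteq> r; q \<noteq> r\<rbrakk> \<Longrightarrow> R p q r = R q p r"
    and swap23: "\<And>p q r. \<lbrakk>p \<in> U; q \<in> U; r \<in> U; p \<noteq> q; p \<noteq> r; q \<noteq> r\<rbrakk> \<Longrightarrow> R p q r = R p r q"

text \<open>The coordinates of \<open>x q\<close> are the monomials in the entries of \<open>q\<close>.\<close>

lemma ex_veronese_map:
  "\<exists>D. \<exists>x :: point \<Rightarrow> nat \<Rightarrow> real. \<forall>f\<in>mpolys (3 * d) t. \<forall>p\<in>points d. \<forall>p'\<in>points d.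
     \<exists>a. \<forall>q\<in>points d. mpoly_value f (\<lambda>i. concat [p, p', q] ! i) = lin D a (x q)"
proof -
  define M where "M = (\<Pi>\<^sub>E i\<in>{..<d}. {..t})"
  have finM: "finite M" unfolding M_def by (rule finite_PiE) auto
  obtain h where h: "bij_betw h {..<card M} M"
    using ex_bij_betw_nat_finite[OF finM] by (auto simp: atLeast0LessThan)
  define x where "x q l = (\<Prod>i<d. q ! i ^ h l i)" for q :: point and l
  have "\<exists>a. \<forall>q\<in>points d. mpoly_value f (\<lambda>i. concat [p, p', q] ! i) = lin (card M) a (x q)"
    if f: "f \<in> mpolys (3 * d) t" and p: "p \<in> points d" "p' \<in> points d" for f p p'
  proof -
    \<comment> \<open>An exponent vector is split into its last block, belonging to
      \<open>q\<close>, and the rest, whose monomial is evaluated at \<open>p, p'\<close> and merged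
      into the coefficient. Terms with the same last block are collected.\<close>
    define v where "v e = (\<lambda>i\<in>{..<d}. Poly_Mapping.lookup e (2 * d + i))" for e :: "nat \<Rightarrow>\<^sub>0 nat"
    define c where "c e = Poly_Mapping.lookup f e *
      (\<Prod>i<2 * d. concat [p, p'] ! i ^ Poly_Mapping.lookup e i)" for e
    define a where "a l = (\<Sum>e\<in>{e \<in> Poly_Mapping.keys f. v e = h l}. c e)" for l
    have vM: "v ` Poly_Mapping.keys f \<subseteq> M"
    proof
      fix w assume "w \<in> v ` Poly_Mapping.keys f"
      then obtain e where e: "e \<in> Poly_Mapping.keys f" "w = v e" by auto
      have "Poly_Mapping.lookup e j \<le> t" for j
      proof (cases "j \<in> Poly_Mapping.keys e")
        case True
        then have "Poly_Mapping.lookup e j \<le> (\<Sum>i\<in>Poly_Mapping.keys e. Poly_Mapping.lookup e i)"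
          by (intro member_le_sum) auto
        also have "\<dots> \<le> t" using f e(1) by (auto simp: mpolys_def)
        finally show ?thesis .
      qed (simp add: in_keys_iff)
      then show "w \<in> M" by (auto simp: e(2) M_def v_def)
    qed
    have "mpoly_value f (\<lambda>i. concat [p, p', q] ! i) = lin (card M) a (x q)" if q: "q \<in> points d" for q
    proof -
      let ?X = "\<lambda>i. concat [p, p', q] ! i"
      have monom: "Poly_Mapping.lookup f e * (\<Prod>i\<in>Poly_Mapping.keys e. ?X i ^ Poly_Mapping.lookup e i)
         = c e * (\<Prod>i<d. q ! i ^ v e i)" if e: "e \<in> Poly_Mapping.keys f" for e
      proof -
        have "(\<Prod>i\<in>Poly_Mapping.keys e. ?X i ^ Poly_Mapping.lookup e i)
            = (\<Prod>i<3 * d. ?X i ^ Poly_Mapping.lookup e i)"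
          using f e by (intro prod.mono_neutral_left) (auto simp: mpolys_def in_keys_iff)
        also have "{..<3 * d} = {..<2 * d} \<union> (\<lambda>i. 2 * d + i) ` {..<d}"
        proof -
          have "i \<in> (\<lambda>i. 2 * d + i) ` {..<d}" if "\<not> i < 2 * d" "i < 3 * d" for i
            using that by (intro image_eqI[of _ _ "i - 2 * d"]) auto
          then show ?thesis by auto
        qed
        also have "(\<Prod>i\<in>\<dots>. ?X i ^ Poly_Mapping.lookup e i)
            = (\<Prod>i<2 * d. ?X i ^ Poly_Mapping.lookup e i)
              * (\<Prod>i<d. ?X (2 * d + i) ^ Poly_Mapping.lookup e (2 * d + i))"
          by (subst prod.union_disjoint) (auto simp: prod.reindex)
        also have "(\<Prod>i<2 * d. ?X i ^ Poly_Mapping.lookup e i)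
            = (\<Prod>i<2 * d. concat [p, p'] ! i ^ Poly_Mapping.lookup e i)"
          using p by (intro prod.cong) (auto simp: nth_append points_def)
        also have "(\<Prod>i<d. ?X (2 * d + i) ^ Poly_Mapping.lookup e (2 * d + i)) = (\<Prod>i<d. q ! i ^ v e i)"
          using p by (intro prod.cong) (auto simp: nth_append points_def v_def)
        finally show ?thesis by (simp add: c_def)
      qed
      have "mpoly_value f ?X = (\<Sum>e\<in>Poly_Mapping.keys f. c e * (\<Prod>i<d. q ! i ^ v e i))"
        unfolding mpoly_value_def by (rule sum.cong) (use monom in auto)
      also have "\<dots> = (\<Sum>w\<in>M. \<Sum>e\<in>{e \<in> Poly_Mapping.keys f. v e = w}. c e * (\<Prod>i<d. q ! i ^ v e i))"
        by (rule sum.group[symmetric]) (use vM finM in auto)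
      also have "\<dots> = (\<Sum>w\<in>M. (\<Sum>e\<in>{e \<in> Poly_Mapping.keys f. v e = w}. c e) * (\<Prod>i<d. q ! i ^ w i))"
        by (intro sum.cong refl) (auto simp: sum_distrib_right)
      also have "\<dots> = (\<Sum>l<card M. (\<Sum>e\<in>{e \<in> Poly_Mapping.keys f. v e = h l}. c e) * (\<Prod>i<d. q ! i ^ h l i))"
        using sum.reindex_bij_betw[OF h, symmetric] .
      finally show ?thesis by (simp add: lin_def a_def x_def)
    qed
    then show ?thesis by blast
  qed
  then show ?thesis by blast
qed

text \<open>If the condition is not constant on \<open>A\<close> for a pair, then one of its
  \<open>t\<close> forms changes sign on \<open>A\<close>. Cutting all \<open>t * card F\<close>
  forms with precision \<open>e + t\<close> absorbs the factor \<open>t\<close>, since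
  \<open>t \<le> 2^t\<close>. \<open>C\<close> is chosen before \<open>fs\<close> and
  \<open>\<Phi>\<close> and so depends only on \<open>d\<close> and \<open>t\<close>.\<close>

lemma ex_semialg_cutting:
  "\<exists>C. \<forall>fs \<Phi> F X e. length fs = t \<longrightarrow> set fs \<subseteq> mpolys (3 * d) t \<longrightarrow>
     F \<subseteq> points d \<times> points d \<longrightarrow> finite F \<longrightarrow> X \<subseteq> points d \<longrightarrow> finite X \<longrightarrow>
     (\<exists>A\<subseteq>X. card X \<le> 2 ^ (C * (e + 1)) * card A \<and>
        card {f \<in> F. \<exists>x\<in>A. \<exists>z\<in>A. semialg_cond fs \<Phi> [fst f, snd f, x] \<noteq> semialg_cond fs \<Phi> [fst f, snd f, z]}
          * 2 ^ e \<le> card F)"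
proof -
  obtain D and x :: "point \<Rightarrow> nat \<Rightarrow> real" where x: "\<forall>f\<in>mpolys (3 * d) t. \<forall>p\<in>points d. \<forall>p'\<in>points d.
     \<exists>a. \<forall>q\<in>points d. mpoly_value f (\<lambda>i. concat [p, p', q] ! i) = lin D a (x q)"
    using ex_veronese_map by blast
  obtain C where C: "lin_cutting x D C" using ex_lin_cutting by blast
  have main: "\<exists>A\<subseteq>X. card X \<le> 2 ^ (C * (t + 1) * (e + 1)) * card A \<and>
        card {f \<in> F. \<exists>x\<in>A. \<exists>z\<in>A. semialg_cond fs \<Phi> [fst f, snd f, x] \<noteq> semialg_cond fs \<Phi> [fst f, snd f, z]}
          * 2 ^ e \<le> card F"
    if fs: "length fs = t" "set fs \<subseteq> mpolys (3 * d) t" and F: "F \<subseteq> points d \<times> points d" "finite F"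
      and X: "X \<subseteq> points d" "finite X" for fs \<Phi> F X e
  proof -
    let ?val = "\<lambda>l f q. mpoly_value (fs ! l) (\<lambda>i. concat [fst f, snd f, q] ! i)"
    have "\<forall>lf\<in>{..<t} \<times> F. \<exists>a. \<forall>q\<in>points d. ?val (fst lf) (snd lf) q = lin D a (x q)"
      using x fs F(1) by (fastforce simp: subset_iff)
    then obtain a where a: "\<And>l f q. \<lbrakk>l < t; f \<in> F; q \<in> points d\<rbrakk> \<Longrightarrow> ?val l f q = lin D (a (l, f)) (x q)"
      by (metis SigmaI fst_conv lessThan_iff snd_conv)
    obtain A where A: "A \<subseteq> X" "card X \<le> 2 ^ (C * (e + t + 1)) * card A"
      "card {i \<in> {..<t} \<times> F. changes_sign (\<lambda>p. lin D (a i) (x p)) A} * 2 ^ (e + t) \<le> card ({..<t} \<times> F)"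
      using lin_cuttingE[OF C X(2) finite_cartesian_product[OF finite_lessThan F(2)], of "e + t" t a] by blast
    let ?S = "{f \<in> F. \<exists>x\<in>A. \<exists>z\<in>A. semialg_cond fs \<Phi> [fst f, snd f, x] \<noteq> semialg_cond fs \<Phi> [fst f, snd f, z]}"
    let ?B = "{i \<in> {..<t} \<times> F. changes_sign (\<lambda>p. lin D (a i) (x p)) A}"
    have "?S \<subseteq> snd ` ?B"
    proof
      fix f assume "f \<in> ?S"
      then obtain p q where pq: "f \<in> F" "p \<in> A" "q \<in> A"
        "semialg_cond fs \<Phi> [fst f, snd f, p] \<noteq> semialg_cond fs \<Phi> [fst f, snd f, q]" by blast
      have "\<exists>l<t. (0 \<le> ?val l f p) \<noteq> (0 \<le> ?val l f q)"
      proof (rule ccontr)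
        assume "\<not> ?thesis"
        then have "map (\<lambda>g. 0 \<le> mpoly_value g (\<lambda>i. concat [fst f, snd f, p] ! i)) fs
          = map (\<lambda>g. 0 \<le> mpoly_value g (\<lambda>i. concat [fst f, snd f, q] ! i)) fs"
          using fs(1) by (intro nth_equalityI) auto
        then have "semialg_cond fs \<Phi> [fst f, snd f, p] = semialg_cond fs \<Phi> [fst f, snd f, q]"
          unfolding semialg_cond_def by (rule arg_cong)
        then show False using pq(4) by simp
      qed
      then obtain l where l: "l < t" "(0 \<le> ?val l f p) \<noteq> (0 \<le> ?val l f q)" by blast
      then have "(0 \<le> lin D (a (l, f)) (x p)) \<noteq> (0 \<le> lin D (a (l, f)) (x q))"
        using a[OF l(1) pq(1), of p] a[OF l(1) pq(1), of q] subsetD[OF subset_trans[OF A(1) X(1)]] pq(2,3)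
        by simp
      then have "sgn (lin D (a (l, f)) (x p)) \<noteq> sgn (lin D (a (l, f)) (x q))"
        by (metis sgn_less not_le)
      then have "(l, f) \<in> ?B" using l pq by (auto simp: changes_sign_def)
      then show "f \<in> snd ` ?B" by force
    qed
    then have "card ?S \<le> card ?B"
      using F(2) by (intro surj_card_le) auto
    then have "card ?S * 2 ^ (e + t) \<le> card ?B * 2 ^ (e + t)" by (rule mult_le_mono1)
    also have "\<dots> \<le> t * card F" using A(3) by (simp add: card_cartesian_product)
    also have "\<dots> \<le> 2 ^ t * card F" by (intro mult_le_mono1) (simp add: less_imp_le)
    finally have "card ?S * 2 ^ e \<le> card F" by (simp add: power_add)
    moreover have "C * (e + t + 1) \<le> C * ((t + 1) * (e + 1))" by (intro mult_le_mono2) simp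
    then have "2 ^ (C * (e + t + 1)) * card A \<le> 2 ^ (C * (t + 1) * (e + 1)) * card A"
      unfolding mult.assoc[of C] by (intro mult_le_mono1 power_increasing) auto
    then have "card X \<le> 2 ^ (C * (t + 1) * (e + 1)) * card A" by (rule le_trans[OF A(2)])
    ultimately show ?thesis using A(1) by blast
  qed
  show ?thesis
    by (intro exI[of _ "C * (t + 1)"] allI impI) (rule main)
qed

text \<open>The Boolean condition itself serves as \<open>R\<close>: unlike \<open>E\<close> it
  makes sense for repeated points, which the cutting property has to cover.\<close>

lemma ex_cuttable_semialg:
  "\<exists>C. \<forall>P E. symmetric_semialg_relation d t 3 P E \<longrightarrow>
    (\<exists>R. cuttable_relation C (set P) R \<and>
       (\<forall>p\<in>set P. \<forall>q\<in>set P. \<forall>r\<in>set P. p \<noteq> q \<and> p \<noteq> r \<and> q \<noteq> r \<longrightarrow> (R p q r \<longleftrightarrow> {p, q, r} \<in> E)))"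
proof -
  obtain C where C: "\<forall>fs \<Phi> F X e. length fs = t \<longrightarrow> set fs \<subseteq> mpolys (3 * d) t \<longrightarrow>
     F \<subseteq> points d \<times> points d \<longrightarrow> finite F \<longrightarrow> X \<subseteq> points d \<longrightarrow> finite X \<longrightarrow>
     (\<exists>A\<subseteq>X. card X \<le> 2 ^ (C * (e + 1)) * card A \<and>
        card {f \<in> F. \<exists>x\<in>A. \<exists>z\<in>A. semialg_cond fs \<Phi> [fst f, snd f, x] \<noteq> semialg_cond fs \<Phi> [fst f, snd f, z]}
          * 2 ^ e \<le> card F)"
    using ex_semialg_cutting[of t d] ..
  have main: "\<exists>R. cuttable_relation C (set P) R \<and>
       (\<forall>p\<in>set P. \<forall>q\<in>set P. \<forall>r\<in>set P. p \<noteq> q \<and> p \<noteq> r \<and> q \<noteq> r \<longrightarrow> (R p q r \<longleftrightarrow> {p, q, r} \<in> E))"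
    if sym: "symmetric_semialg_relation d t 3 P E" for P E
  proof -
    obtain fs \<Phi> where fs: "set P \<subseteq> points d" "length fs = t" "set fs \<subseteq> mpolys (3 * d) t"
      and E: "\<And>qs. qs \<in> increasing_tuples 3 P \<Longrightarrow> set qs \<in> E \<longleftrightarrow> semialg_cond fs \<Phi> qs"
      and perm: "\<And>qs rs. qs \<in> increasing_tuples 3 P \<Longrightarrow> mset rs = mset qs \<Longrightarrow>
           semialg_cond fs \<Phi> qs \<longleftrightarrow> semialg_cond fs \<Phi> rs"
      using sym unfolding symmetric_semialg_relation_def semialg_described_by_def by blast
    define R where "R p q r = semialg_cond fs \<Phi> [p, q, r]" for p q r
    have R: "R p q r \<longleftrightarrow> {p, q, r} \<in> E"
      if "p \<in> set P" "q \<in> set P" "r \<in> set P" "p \<noteq> q" "p \<noteq> r" "q \<noteq> r" for p q r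
    proof -
      obtain i j k where ijk: "i < length P" "j < length P" "k < length P" "p = P ! i" "q = P ! j" "r = P ! k"
        using \<open>p \<in> set P\<close> \<open>q \<in> set P\<close> \<open>r \<in> set P\<close> by (metis in_set_conv_nth)
      \<comment> \<open>Only increasing tuples are tied to \<open>E\<close>; the symmetry hypothesis
        carries the condition over from the sorted triple.\<close>
      define js where "js = sort [i, j, k]"
      have dist: "distinct [i, j, k]" using ijk that by auto
      have "sorted_wrt (<) js"
        unfolding js_def using dist by (metis sorted_sort distinct_sort strict_sorted_iff)
      moreover have "length js = 3" "set js \<subseteq> {..<length P}" using ijk by (auto simp: js_def)
      ultimately have inc: "map ((!) P) js \<in> increasing_tuples 3 P" unfolding increasing_tuples_def by blast
      have ms: "mset [p, q, r] = mset (map ((!) P) js)" using ijk by (simp add: js_def)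
      then have "set (map ((!) P) js) = {p, q, r}" by (metis set_mset_mset list.set(1,2))
      then show ?thesis using E[OF inc] perm[OF inc ms] by (simp add: R_def)
    qed
    have "cuttable_relation C (set P) R"
    proof
      fix F X e assume "F \<subseteq> set P \<times> set P" "finite F" "X \<subseteq> set P" "finite X"
      then show "\<exists>A\<subseteq>X. card X \<le> 2 ^ (C * (e + 1)) * card A \<and>
        card {f \<in> F. \<exists>x\<in>A. \<exists>z\<in>A. R (fst f) (snd f) x \<noteq> R (fst f) (snd f) z} * 2 ^ e \<le> card F"
        unfolding R_def using fs by (intro C[rule_format]) auto
    next
      fix p q r assume pqr: "p \<in> set P" "q \<in> set P" "r \<in> set P" "p \<noteq> q" "p \<noteq> r" "q \<noteq> r"
      show "R p q r = R q p r" using R[of p q r] R[of q p r] pqr by (simp add: insert_commute)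
      show "R p q r = R p r q" using R[of p q r] R[of p r q] pqr by (simp add: insert_commute)
    qed
    then show ?thesis using R by blast
  qed
  show ?thesis by (intro exI[of _ C] allI impI) (rule main)
qed

section \<open>Two general Ramsey lemmas\<close>

lemma ex_disjoint_subsets:
  assumes "finite V" and "m * n \<le> card V"
  shows "\<exists>Q. (\<forall>i<m. Q i \<subseteq> V \<and> card (Q i) = n) \<and> (\<forall>i<m. \<forall>j<m. i \<noteq> j \<longrightarrow> Q i \<inter> Q j = {})"
  using assms
proof (induction m arbitrary: V)
  case (Suc m)
  obtain S where S: "S \<subseteq> V" "card S = n"
    using obtain_subset_with_card_n[of n V] Suc.prems by auto
  have "m * n \<le> card (V - S)"
    using Suc.prems S by (simp add: card_Diff_subset finite_subset)
  then obtain Q where Q: "\<forall>i<m. Q i \<subseteq> V - S \<and> card (Q i) = n"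
    "\<forall>i<m. \<forall>j<m. i \<noteq> j \<longrightarrow> Q i \<inter> Q j = {}"
    using Suc.IH[of "V - S"] Suc.prems(1) by auto
  have "(Q(m := S)) i \<inter> (Q(m := S)) j = {}" if "i < Suc m" "j < Suc m" "i \<noteq> j" for i j
  proof -
    have "Q l \<inter> S = {}" if "l < m" for l using Q(1) that by blast
    moreover have "Q i \<inter> Q j = {}" if "i < m" "j < m" using Q(2) that \<open>i \<noteq> j\<close> by blast
    ultimately show ?thesis using that by (auto simp: less_Suc_eq)
  qed
  moreover have "\<forall>i<Suc m. (Q(m := S)) i \<subseteq> V \<and> card ((Q(m := S)) i) = n"
    using Q(1) S by (auto simp: less_Suc_eq)
  ultimately show ?case by blast
qed simp

text \<open>A maximum independent set has fewer than \<open>m\<close> points and every other vertex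
  is adjacent to one of them, so one of its points has at least \<open>m ^ s\<close> neighbours, to
  which the induction applies.\<close>

lemma ramsey_power_bound:
  assumes "finite V" and "m ^ s \<le> card V" and "symp G"
  shows "(\<exists>S\<subseteq>V. card S = s \<and> pairwise G S) \<or> (\<exists>T\<subseteq>V. card T = m \<and> pairwise (\<lambda>x y. \<not> G x y) T)"
  using assms(1,2)
proof (induction s arbitrary: V)
  case 0
  then show ?case by (intro disjI1 exI[of _ "{}"]) auto
next
  case (Suc s)
  show ?case
  proof (rule ccontr)
    assume neg: "\<not> ?thesis"
    let ?ind = "\<lambda>I. I \<subseteq> V \<and> pairwise (\<lambda>x y. \<not> G x y) I"
    have small: "card I < m" if "?ind I" for I
    proof (rule ccontr)
      assume "\<not> card I < m"
      then obtain T where "T \<subseteq> I" "card T = m"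
        using obtain_subset_with_card_n[of m I] by auto
      moreover have "T \<subseteq> V" "pairwise (\<lambda>x y. \<not> G x y) T"
        using that \<open>T \<subseteq> I\<close> pairwise_subset by blast+
      ultimately show False using neg by blast
    qed
    have "?ind {}" by simp
    then obtain I where I: "?ind I" and max: "\<And>I'. ?ind I' \<Longrightarrow> card I' \<le> card I"
      using ex_has_greatest_nat[of ?ind "{}" card m] small by (metis less_imp_le)
    have finI: "finite I" using I Suc.prems(1) finite_subset by blast
    define N where "N w = {v \<in> V. v \<noteq> w \<and> G w v}" for w
    have finN: "finite (N w)" for w using Suc.prems(1) by (simp add: N_def)
    have cover: "V \<subseteq> (\<Union>w\<in>I. insert w (N w))"
    proof
      fix v assume v: "v \<in> V"
      show "v \<in> (\<Union>w\<in>I. insert w (N w))"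
      proof (rule ccontr)
        assume no: "v \<notin> (\<Union>w\<in>I. insert w (N w))"
        then have "v \<notin> I" "\<And>w. w \<in> I \<Longrightarrow> \<not> G w v" using v by (auto simp: N_def)
        then have "?ind (insert v I)"
          using I v assms(3) by (auto simp: pairwise_insert dest: sympD)
        then show False using max[of "insert v I"] \<open>v \<notin> I\<close> finI by simp
      qed
    qed
    have "\<exists>w\<in>I. m ^ s \<le> card (N w)"
    proof (rule ccontr)
      assume "\<not> ?thesis"
      \<comment> \<open>Fewer than \<open>m ^ s\<close> neighbours leave room for \<open>w\<close>
        itself.\<close>
      then have "card (insert w (N w)) \<le> m ^ s" if "w \<in> I" for w
        using card_insert_le_m1[of "m ^ s" "N w" w] that finN by (fastforce simp: card_insert_if)
      then have "card (\<Union>w\<in>I. insert w (N w)) \<le> card I * m ^ s"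
        by (intro order.trans[OF card_UN_le[OF finI]] sum_bounded_above[where K = "m ^ s", simplified])
      moreover have "card V \<le> card (\<Union>w\<in>I. insert w (N w))"
        using cover finI finN by (intro card_mono) auto
      ultimately have "m * m ^ s \<le> card I * m ^ s" using Suc.prems(2) unfolding power_Suc by linarith
      then show False using small[OF I] by simp
    qed
    then obtain w where w: "w \<in> I" "m ^ s \<le> card (N w)" by blast
    consider S where "S \<subseteq> N w" "card S = s" "pairwise G S"
      | T where "T \<subseteq> N w" "card T = m" "pairwise (\<lambda>x y. \<not> G x y) T"
      using Suc.IH[OF finN w(2)] by blast
    then show False
    proof cases
      case 1
      then have fS: "finite S" and "w \<notin> S" using finN finite_subset N_def by blast+
      then have "insert w S \<subseteq> V" "card (insert w S) = Suc s"
        using 1 w I by (auto simp: N_def)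
      moreover have "pairwise G (insert w S)"
        using 1 assms(3) by (auto simp: pairwise_insert N_def dest: sympD)
      ultimately show False using neg by blast
    next
      case 2
      then have "T \<subseteq> V" by (auto simp: N_def)
      then show False using 2 neg by blast
    qed
  qed
qed

text \<open>Each split joins its two sides completely in one graph \<open>G v\<close>, so the sets
  found for \<open>v\<close> on both sides can be united, while for every other index the larger set
  is kept. The new product is at least the sum of the two old ones, so it doubles with each level of
  splitting, at a cost of \<open>c\<close> bits.\<close>

lemma cograph_product:
  fixes G :: "'w \<Rightarrow> 'a \<Rightarrow> 'a \<Rightarrow> bool"
  assumes finI: "finite I"
    and split: "\<And>X u. X \<subseteq> V \<Longrightarrow> 2 ^ (u + c) \<le> card X \<Longrightarrow>
      \<exists>A B w. A \<subseteq> X \<and> B \<subseteq> X \<and> A \<inter> B = {} \<and> 2 ^ u \<le> card A \<and> 2 ^ u \<le> card B \<and> w \<in> I \<and>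
        (\<forall>a\<in>A. \<forall>b\<in>B. G w a b \<and> G w b a)"
    and X: "X \<subseteq> V" "finite V" "2 ^ (k * c) \<le> card X"
  shows "\<exists>S. (\<forall>w\<in>I. S w \<subseteq> X \<and> pairwise (G w) (S w)) \<and> 2 ^ k \<le> (\<Prod>w\<in>I. card (S w))"
  using X
proof (induction k arbitrary: X)
  case 0
  then obtain x where "x \<in> X" by (metis card.empty ex_in_conv mult_0 not_one_le_zero power_0)
  then show ?case by (intro exI[of _ "\<lambda>_. {x}"]) auto
next
  case (Suc k)
  obtain A B v where AB: "A \<subseteq> X" "B \<subseteq> X" "A \<inter> B = {}" "2 ^ (k * c) \<le> card A" "2 ^ (k * c) \<le> card B"
    and v: "v \<in> I" "\<forall>a\<in>A. \<forall>b\<in>B. G v a b \<and> G v b a"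
    using split[OF Suc.prems(1), of "k * c"] Suc.prems(3) by (auto simp: add.commute)
  obtain S where S: "\<forall>w\<in>I. S w \<subseteq> A \<and> pairwise (G w) (S w)" "2 ^ k \<le> (\<Prod>w\<in>I. card (S w))"
    using Suc.IH[of A] AB(1,4) Suc.prems(1,2) by blast
  obtain T where T: "\<forall>w\<in>I. T w \<subseteq> B \<and> pairwise (G w) (T w)" "2 ^ k \<le> (\<Prod>w\<in>I. card (T w))"
    using Suc.IH[of B] AB(2,5) Suc.prems(1,2) by blast
  define Z where "Z w = (if w = v then S w \<union> T w else if card (S w) \<le> card (T w) then T w else S w)" for w
  have fin: "finite (S v)" "finite (T v)"
    using S(1) T(1) v(1) AB Suc.prems by (meson finite_subset)+
  have "card (Z v) = card (S v) + card (T v)"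
  proof -
    have "S v \<inter> T v = {}" using S(1) T(1) v(1) AB(3) by blast
    then show ?thesis unfolding Z_def using card_Un_disjoint[OF fin] by simp
  qed
  moreover have "(\<Prod>w\<in>I - {v}. card (S w)) \<le> (\<Prod>w\<in>I - {v}. card (Z w))"
    by (intro prod_mono) (auto simp: Z_def)
  moreover have "(\<Prod>w\<in>I - {v}. card (T w)) \<le> (\<Prod>w\<in>I - {v}. card (Z w))"
    by (intro prod_mono) (auto simp: Z_def)
  ultimately have "card (S v) * (\<Prod>w\<in>I - {v}. card (S w)) + card (T v) * (\<Prod>w\<in>I - {v}. card (T w))
      \<le> card (Z v) * (\<Prod>w\<in>I - {v}. card (Z w))"
    by (simp add: add_mult_distrib add_mono)
  then have "2 ^ Suc k \<le> (\<Prod>w\<in>I. card (Z w))"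
    using S(2) T(2) by (simp add: prod.remove[OF finI v(1)])
  moreover have "Z w \<subseteq> X \<and> pairwise (G w) (Z w)" if w: "w \<in> I" for w
  proof (cases "w = v")
    case True
    have "pairwise (G v) (S v \<union> T v)"
      using S(1) T(1) v unfolding pairwise_def by (metis Un_iff subsetD)
    moreover have "S v \<union> T v \<subseteq> X" using S(1) T(1) v(1) AB(1,2) by blast
    ultimately show ?thesis using True by (simp add: Z_def)
  next
    case False
    moreover have "S w \<subseteq> X" "T w \<subseteq> X" using S(1) T(1) w AB(1,2) by blast+
    ultimately show ?thesis using S(1) T(1) w unfolding Z_def by simp
  qed
  ultimately show ?case by blast
qed

section \<open>Homogeneous parts\<close>

context cuttable_relation
begin

text \<open>For fewer than \<open>2 ^ e\<close> pairs a proportion \<open>2^-e\<close> is less than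
  one pair, so no exceptional pair remains.\<close>

lemma cell:
  assumes F: "F \<subseteq> U \<times> U" "finite F" "card F < 2 ^ e" and X: "X \<subseteq> U" "finite X"
    and card: "2 ^ (C * (e + 1) + k) \<le> card X"
  obtains A where "A \<subseteq> X" "card A = 2 ^ k"
    "\<And>p q x z. \<lbrakk>(p, q) \<in> F; x \<in> A; z \<in> A\<rbrakk> \<Longrightarrow> R p q x = R p q z"
proof -
  let ?bad = "\<lambda>A. {f \<in> F. \<exists>x\<in>A. \<exists>z\<in>A. R (fst f) (snd f) x \<noteq> R (fst f) (snd f) z}"
  obtain A where A: "A \<subseteq> X" "card X \<le> 2 ^ (C * (e + 1)) * card A" "card (?bad A) * 2 ^ e \<le> card F"
    using cutting[OF F(1,2) X] by blast
  have "card (?bad A) * 2 ^ e < 1 * 2 ^ e" using le_less_trans[OF A(3) F(3)] by simp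
  then have "card (?bad A) < 1" unfolding mult_less_cancel2 by blast
  then have bad0: "card (?bad A) = 0" by simp
  have const: "R p q x = R p q z" if "(p, q) \<in> F" "x \<in> A" "z \<in> A" for p q x z
  proof (rule ccontr)
    assume "R p q x \<noteq> R p q z"
    then have "(p, q) \<in> ?bad A" using that by auto
    moreover have "finite (?bad A)" using F(2) by (rule finite_subset[rotated]) blast
    ultimately show False using bad0 unfolding card_eq_0_iff by blast
  qed
  have "2 ^ (C * (e + 1)) * 2 ^ k \<le> 2 ^ (C * (e + 1)) * card A"
    using le_trans[OF card A(2)] unfolding power_add .
  then have "2 ^ k \<le> card A" by simp
  then obtain B where B: "B \<subseteq> A" "card B = 2 ^ k" by (rule obtain_subset_with_card_n)
  show ?thesis
    by (rule that[of B]) (use B A(1) in blast, rule B(2), rule const, assumption, (use B(1) in blast)+)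
qed

lemma R_perm:
  assumes "p \<in> U" "q \<in> U" "r \<in> U" "p \<noteq> q" "p \<noteq> r" "q \<noteq> r"
  shows "R q p r = R p q r" "R p r q = R p q r" "R q r p = R p q r" "R r p q = R p q r" "R r q p = R p q r"
  using assms swap12 swap23 by metis+

text \<open>The bits that \<open>cell\<close> needs to leave \<open>2 ^ k\<close> points against all
  pairs of points from \<open>2 ^ b\<close> parts of size \<open>2 ^ k\<close>: there are at most
  \<open>2^(2 * (b + k))\<close> such pairs, hence precision \<open>2 * (b + k) + 1\<close>.\<close>

definition cost :: "nat \<Rightarrow> nat \<Rightarrow> nat" where
  "cost b k = C * (2 * (b + k) + 2) + k"

text \<open>Each part is cut against the pairs from the parts already thinned. These are small, so
  the number of pairs is controlled although the original parts may be huge. The case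
  \<open>i = j\<close> is included and yields the triples of type 2+1.\<close>

lemma homogeneous_forward:
  assumes "M \<le> (2::nat) ^ b" and "\<forall>k<M. Q k \<subseteq> U \<and> finite (Q k) \<and> 2 ^ cost b x \<le> card (Q k)"
  shows "\<exists>X. (\<forall>k<M. X k \<subseteq> Q k \<and> card (X k) = 2 ^ x) \<and>
    (\<forall>k<M. \<forall>i<k. \<forall>j<k. \<forall>p\<in>X i. \<forall>q\<in>X j. \<forall>r\<in>X k. \<forall>r'\<in>X k. R p q r = R p q r')"
  using assms
proof (induction M)
  case (Suc M)
  then obtain X where X: "\<forall>k<M. X k \<subseteq> Q k \<and> card (X k) = 2 ^ x"
    "\<forall>k<M. \<forall>i<k. \<forall>j<k. \<forall>p\<in>X i. \<forall>q\<in>X j. \<forall>r\<in>X k. \<forall>r'\<in>X k. R p q r = R p q r'"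
    by auto
  define W where "W = (\<Union>i<M. X i)"
  have finX: "finite (X i)" "X i \<subseteq> U" if "i < M" for i
    using X(1) Suc.prems(2) that by (meson finite_subset less_SucI subset_trans)+
  have W: "W \<subseteq> U" "finite W" using finX by (auto simp: W_def)
  have "card W \<le> (\<Sum>i<M. card (X i))" unfolding W_def by (rule card_UN_le) simp
  also have "\<dots> = M * 2 ^ x" using X(1) by simp
  also have "\<dots> \<le> 2 ^ b * 2 ^ x" using Suc.prems(1) by (intro mult_le_mono1) simp
  finally have "card W \<le> 2 ^ (b + x)" by (simp add: power_add)
  then have "card W * card W \<le> 2 ^ (b + x) * 2 ^ (b + x)" by (intro mult_le_mono)
  also have "\<dots> < 2 ^ (2 * (b + x) + 1)" by (simp add: power_add mult_2)
  finally have cF: "card (W \<times> W) < 2 ^ (2 * (b + x) + 1)" by (simp add: card_cartesian_product)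
  have "2 ^ (C * (2 * (b + x) + 1 + 1) + x) \<le> card (Q M)"
    using Suc.prems(2)[rule_format, of M] by (simp add: cost_def)
  then obtain A where A: "A \<subseteq> Q M" "card A = 2 ^ x"
    "\<And>p q r z. \<lbrakk>(p, q) \<in> W \<times> W; r \<in> A; z \<in> A\<rbrakk> \<Longrightarrow> R p q r = R p q z"
    using cell[OF _ _ cF, of "Q M" x] W Suc.prems(2)[rule_format, of M] by blast
  let ?X = "X(M := A)"
  have "R p q r = R p q r'"
    if "k < Suc M" "i < k" "j < k" "p \<in> ?X i" "q \<in> ?X j" "r \<in> ?X k" "r' \<in> ?X k" for k i j p q r r'
  proof (cases "k = M")
    case True
    then have "(p, q) \<in> W \<times> W" using that by (auto simp: W_def)
    moreover have "r \<in> A" "r' \<in> A" using that True by auto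
    ultimately show ?thesis by (rule A(3))
  next
    case False
    then have "k < M" using that(1) by simp
    then have "p \<in> X i" "q \<in> X j" "r \<in> X k" "r' \<in> X k" using that by auto
    then show ?thesis using X(2) \<open>k < M\<close> that(2,3) by blast
  qed
  moreover have "\<forall>k<Suc M. ?X k \<subseteq> Q k \<and> card (?X k) = 2 ^ x"
    using X(1) A by (auto simp: less_Suc_eq)
  ultimately show ?case by blast
qed simp

lemma homogeneous_backward:
  assumes "M \<le> (2::nat) ^ b" and "\<forall>k<M. Q k \<subseteq> U \<and> finite (Q k) \<and> 2 ^ cost b x \<le> card (Q k)"
  shows "\<exists>X. (\<forall>k<M. X k \<subseteq> Q k \<and> card (X k) = 2 ^ x) \<and>
    (\<forall>k i j. k < i \<and> k < j \<and> i < M \<and> j < M \<longrightarrow>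
      (\<forall>p\<in>X i. \<forall>q\<in>X j. \<forall>r\<in>X k. \<forall>r'\<in>X k. R p q r = R p q r'))"
proof -
  have "\<forall>k<M. Q (M - 1 - k) \<subseteq> U \<and> finite (Q (M - 1 - k)) \<and> 2 ^ cost b x \<le> card (Q (M - 1 - k))"
    using assms(2) by simp
  from homogeneous_forward[OF assms(1) this]
  obtain Y where Y: "(\<forall>k<M. Y k \<subseteq> Q (M - 1 - k) \<and> card (Y k) = 2 ^ x) \<and>
    (\<forall>k<M. \<forall>i<k. \<forall>j<k. \<forall>p\<in>Y i. \<forall>q\<in>Y j. \<forall>r\<in>Y k. \<forall>r'\<in>Y k. R p q r = R p q r')" ..
  have sub: "Y (M - 1 - k) \<subseteq> Q k \<and> card (Y (M - 1 - k)) = 2 ^ x" if "k < M" for k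
    using conjunct1[OF Y, rule_format, of "M - 1 - k"] that by simp
  have const: "R p q r = R p q r'" if "k < i \<and> k < j \<and> i < M \<and> j < M"
    "p \<in> Y (M - 1 - i)" "q \<in> Y (M - 1 - j)" "r \<in> Y (M - 1 - k)" "r' \<in> Y (M - 1 - k)" for k i j p q r r'
    by (rule conjunct2[OF Y, rule_format, of "M - 1 - k" "M - 1 - i" "M - 1 - j"]) (use that in auto)
  show ?thesis
    by (intro exI[of _ "\<lambda>k. Y (M - 1 - k)"] conjI allI impI ballI)
      (erule sub[THEN conjunct1] sub[THEN conjunct2] | erule const, assumption+)+
qed

definition cost_factor :: "nat \<Rightarrow> nat" where
  "cost_factor k = C * (4 + 2 * k) + k"

text \<open>All costs are linear in \<open>b\<close>, and \<open>cost_factor\<close> transforms the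
  slope. The three nestings stand for the final, the backward and the forward pass; the summand 1
  pays for cutting the set into \<open>2 ^ b\<close> disjoint parts.\<close>

definition parts_factor :: nat where
  "parts_factor = 1 + cost_factor (cost_factor (cost_factor 1))"

lemma cost_le: "1 \<le> b \<Longrightarrow> x \<le> k * b \<Longrightarrow> cost b x \<le> cost_factor k * b"
proof -
  assume b: "1 \<le> b" and x: "x \<le> k * b"
  have "2 * (b + x) + 2 \<le> (4 + 2 * k) * b" using b x by (simp add: add_mult_distrib)
  then have "C * (2 * (b + x) + 2) \<le> C * ((4 + 2 * k) * b)" by (rule mult_le_mono2)
  then show ?thesis using x by (simp add: cost_def cost_factor_def add_mult_distrib mult.assoc)
qed

text \<open>A forward and a backward pass make the triples with two points in one part depend on the
  other part only through its index; together they also make \<open>R p q r\<close> with \<open>p, q, r\<close> in parts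
  \<open>i < j < k\<close> a function of \<open>q\<close>, which a last pass makes constant.\<close>

lemma homogeneous_parts:
  assumes V: "V \<subseteq> U" "finite V" and b: "1 \<le> b" and card: "2 ^ (parts_factor * b) \<le> card V"
  obtains X :: "nat \<Rightarrow> 'a set" where "\<And>i :: nat. i < 2 ^ b \<Longrightarrow> X i \<subseteq> V \<and> card (X i) = 2 ^ b"
    "\<And>i j :: nat. \<lbrakk>i < 2 ^ b; j < 2 ^ b; i \<noteq> j\<rbrakk> \<Longrightarrow> X i \<inter> X j = {}"
    "\<And>(i :: nat) (j :: nat) p p' q q'. \<lbrakk>i < 2 ^ b; j < 2 ^ b; i \<noteq> j; p \<in> X i; p' \<in> X i; q \<in> X j; q' \<in> X j\<rbrakk>
       \<Longrightarrow> R p p' q = R p p' q'"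
    "\<And>(i :: nat) (j :: nat) (k :: nat) p q r p' q' r'. \<lbrakk>i < j; j < k; k < 2 ^ b; p \<in> X i; q \<in> X j; r \<in> X k;
       p' \<in> X i; q' \<in> X j; r' \<in> X k\<rbrakk> \<Longrightarrow> R p q r = R p' q' r'"
proof -
  let ?M = "2 ^ b :: nat"
  define y where "y = cost b b"
  define x where "x = cost b y"
  define w where "w = cost b x"
  have "y \<le> cost_factor 1 * b" unfolding y_def using cost_le[OF b, of b 1] by simp
  then have "x \<le> cost_factor (cost_factor 1) * b" unfolding x_def by (rule cost_le[OF b])
  then have "w \<le> cost_factor (cost_factor (cost_factor 1)) * b" unfolding w_def by (rule cost_le[OF b])
  then have "b + w \<le> parts_factor * b" by (simp add: parts_factor_def)
  then have "?M * 2 ^ w \<le> (2::nat) ^ (parts_factor * b)"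
    unfolding power_add[symmetric] by (rule power_increasing) simp
  from ex_disjoint_subsets[OF V(2) le_trans[OF this card]]
  obtain Q where Q: "\<forall>i<?M. Q i \<subseteq> V \<and> card (Q i) = 2 ^ w"
    and disj: "\<forall>i<?M. \<forall>j<?M. i \<noteq> j \<longrightarrow> Q i \<inter> Q j = {}"
    by (elim exE conjE)
  have sizes: "Y \<subseteq> U \<and> finite Y \<and> 2 ^ u \<le> card Y" if "Y \<subseteq> V" "card Y = 2 ^ u" for Y u
    using that V finite_subset[of Y V] by auto
  have "\<forall>k<?M. Q k \<subseteq> U \<and> finite (Q k) \<and> 2 ^ cost b x \<le> card (Q k)"
    unfolding w_def[symmetric] by (intro allI impI sizes) (use Q in blast)+
  from homogeneous_forward[of ?M b Q x, OF order_refl this]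
  obtain X1 where X1: "\<forall>k<?M. X1 k \<subseteq> Q k \<and> card (X1 k) = 2 ^ x"
    and fw: "\<forall>k<?M. \<forall>i<k. \<forall>j<k. \<forall>p\<in>X1 i. \<forall>q\<in>X1 j. \<forall>r\<in>X1 k. \<forall>r'\<in>X1 k. R p q r = R p q r'"
    by (elim exE conjE)
  have X1V: "X1 k \<subseteq> V" if "k < ?M" for k using X1 Q that by blast
  have "\<forall>k<?M. X1 k \<subseteq> U \<and> finite (X1 k) \<and> 2 ^ cost b y \<le> card (X1 k)"
    unfolding x_def[symmetric] by (intro allI impI sizes) (use X1 X1V in blast)+
  from homogeneous_backward[of ?M b X1 y, OF order_refl this]
  obtain X2 where X2: "\<forall>k<?M. X2 k \<subseteq> X1 k \<and> card (X2 k) = 2 ^ y"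
    and bw: "\<forall>k i j. k < i \<and> k < j \<and> i < ?M \<and> j < ?M \<longrightarrow>
      (\<forall>p\<in>X2 i. \<forall>q\<in>X2 j. \<forall>r\<in>X2 k. \<forall>r'\<in>X2 k. R p q r = R p q r')"
    by (elim exE conjE)
  have X2V: "X2 k \<subseteq> V" if "k < ?M" for k using X2 X1V that by blast
  define v where "v i = (SOME p. p \<in> X2 i)" for i
  have v: "v i \<in> X2 i" if "i < ?M" for i
  proof -
    have "card (X2 i) \<noteq> 0" using X2 that by simp
    then show ?thesis unfolding v_def some_in_eq by force
  qed
  \<comment> \<open>For \<open>q\<close> in the middle part the value of \<open>R p q r\<close> will
    be \<open>R (v i) (v k) q\<close>, so the last pass has to deal with pairs of representatives
    only.\<close>
  define F where "F = (\<lambda>(i, k). (v i, v k)) ` ({..<?M} \<times> {..<?M})"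
  have finF: "finite F" by (simp add: F_def)
  have "card F \<le> card ({..<?M} \<times> {..<?M})" unfolding F_def by (rule card_image_le) simp
  also have "\<dots> = 2 ^ (2 * b)" by (simp add: card_cartesian_product power_add mult_2)
  also have "\<dots> < (2::nat) ^ (2 * b + 1)" by simp
  finally have cardF: "card F < 2 ^ (2 * b + 1)" .
  have "v i \<in> U" if "i < ?M" for i using v[OF that] X2V[OF that] V(1) by blast
  then have FU: "F \<subseteq> U \<times> U" by (auto simp: F_def)
  have "\<forall>j. \<exists>A. j < ?M \<longrightarrow> A \<subseteq> X2 j \<and> card A = 2 ^ b \<and>
      (\<forall>f\<in>F. \<forall>q\<in>A. \<forall>z\<in>A. R (fst f) (snd f) q = R (fst f) (snd f) z)"
  proof (intro allI, cases)
    fix j assume j: "j < ?M"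
    have "\<exists>A\<subseteq>X2 j. card A = 2 ^ b \<and> (\<forall>f\<in>F. \<forall>q\<in>A. \<forall>z\<in>A. R (fst f) (snd f) q = R (fst f) (snd f) z)"
  proof -
    have fin: "X2 j \<subseteq> U" "finite (X2 j)" using X2V[OF j] V finite_subset by blast+
    \<comment> \<open>\<open>cost b b\<close> allows for pairs of points rather than of
      representatives and thus more than suffices.\<close>
    have "C * (2 * b + 1 + 1) + b \<le> y" unfolding y_def cost_def by (simp add: mult_le_mono2)
    then have "2 ^ (C * (2 * b + 1 + 1) + b) \<le> (2::nat) ^ y" by (rule power_increasing) simp
    also have "\<dots> = card (X2 j)" using X2 j by simp
    finally have cardX2: "2 ^ (C * (2 * b + 1 + 1) + b) \<le> card (X2 j)" .
    obtain A where A: "A \<subseteq> X2 j" "card A = 2 ^ b"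
      "\<And>p q x z. \<lbrakk>(p, q) \<in> F; x \<in> A; z \<in> A\<rbrakk> \<Longrightarrow> R p q x = R p q z"
      using cell[OF FU finF cardF fin cardX2] by blast
    have "R (fst f) (snd f) q = R (fst f) (snd f) z" if "f \<in> F" "q \<in> A" "z \<in> A" for f q z
      by (rule A(3)) (use that in simp_all)
    then show ?thesis using A(1,2) by blast
    qed
    then show "\<exists>A. j < ?M \<longrightarrow> A \<subseteq> X2 j \<and> card A = 2 ^ b \<and>
      (\<forall>f\<in>F. \<forall>q\<in>A. \<forall>z\<in>A. R (fst f) (snd f) q = R (fst f) (snd f) z)" by blast
  qed blast
  from choice[OF this] obtain X where X': "\<forall>j. j < ?M \<longrightarrow> X j \<subseteq> X2 j \<and> card (X j) = 2 ^ b \<and>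
      (\<forall>f\<in>F. \<forall>q\<in>X j. \<forall>z\<in>X j. R (fst f) (snd f) q = R (fst f) (snd f) z)" ..
  then have X: "\<And>j. j < ?M \<Longrightarrow> X j \<subseteq> X2 j" "\<And>j. j < ?M \<Longrightarrow> card (X j) = 2 ^ b" by blast+
  have mid: "R (fst f) (snd f) q = R (fst f) (snd f) z" if "j < ?M" "f \<in> F" "q \<in> X j" "z \<in> X j" for j f q z
    using X' that by blast
  have XV: "X j \<subseteq> V" if "j < ?M" for j using X(1) X2V that by blast
  have Q12: "X j \<subseteq> X1 j" "X1 j \<subseteq> Q j" "X2 j \<subseteq> X1 j" if "j < ?M" for j
    using X(1) X2 X1 that by blast+
  have dX1: "X1 i \<inter> X1 j = {}" if "i < ?M" "j < ?M" "i \<noteq> j" for i j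
    using disj Q12(2) that by blast
  have dX: "X i \<inter> X j = {}" if "i < ?M" "j < ?M" "i \<noteq> j" for i j
    using dX1[OF that] Q12(1) that by blast
  show ?thesis
  proof (rule that[of X])
    fix i assume "i < ?M" then show "X i \<subseteq> V \<and> card (X i) = 2 ^ b" using XV X(2) by blast
  next
    fix i j assume "i < ?M" "j < ?M" "i \<noteq> j" then show "X i \<inter> X j = {}" by (rule dX)
  next
    fix i j p p' q q'
    assume ij: "i < ?M" "j < ?M" "i \<noteq> j" and pq: "p \<in> X i" "p' \<in> X i" "q \<in> X j" "q' \<in> X j"
    show "R p p' q = R p p' q'"
    proof (cases "i < j")
      case True
      have "p \<in> X1 i" "p' \<in> X1 i" "q \<in> X1 j" "q' \<in> X1 j" using pq Q12(1) ij by blast+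
      then show ?thesis using fw ij True by blast
    next
      case False
      have "p \<in> X2 i" "p' \<in> X2 i" "q \<in> X2 j" "q' \<in> X2 j" using pq X(1) ij by blast+
      moreover have "j < i" using False ij by simp
      ultimately show ?thesis using bw ij by blast
    qed
  next
    fix i j k p q r p' q' r'
    assume ijk: "i < j" "j < k" "k < ?M" and pqr: "p \<in> X i" "q \<in> X j" "r \<in> X k" "p' \<in> X i" "q' \<in> X j" "r' \<in> X k"
    have lt: "i < ?M" "j < ?M" "k < ?M" using ijk by auto
    \<comment> \<open>The forward pass replaces the last point by its representative, the backward
      pass the first one; the permutations bring the point to be replaced into the third
      argument.\<close>
    have main: "R p q r = R (v i) (v k) q" if pqr: "p \<in> X i" "q \<in> X j" "r \<in> X k" for p q r
    proof -
      have X1: "p \<in> X1 i" "q \<in> X1 j" "r \<in> X1 k" "v k \<in> X1 k" "v i \<in> X1 i"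
        using pqr Q12 v lt by blast+
      have X2: "p \<in> X2 i" "q \<in> X2 j" "v k \<in> X2 k" "v i \<in> X2 i" using pqr X(1) v lt by blast+
      have U: "p \<in> U" "q \<in> U" "v k \<in> U" "v i \<in> U" using X2 X2V V(1) lt by blast+
      have ne: "p \<noteq> q" "q \<noteq> v k" "p \<noteq> v k" "v i \<noteq> q" "v i \<noteq> v k"
        using X1 dX1[OF lt(1,2)] dX1[OF lt(1,3)] dX1[OF lt(2,3)] ijk by auto
      have "R p q r = R p q (v k)" using fw X1 ijk lt by (meson less_trans)
      also have "\<dots> = R q (v k) p" using R_perm(4)[of q "v k" p] U ne by auto
      also have "\<dots> = R q (v k) (v i)"
        using bw[rule_format, of i j k q "v k" p "v i"] X2 ijk lt by (meson less_trans)
      also have "\<dots> = R (v i) (v k) q" using R_perm(5)[of q "v k" "v i"] U ne by auto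
      finally show ?thesis .
    qed
    have "(v i, v k) \<in> F" using lt by (force simp: F_def)
    then have "R (v i) (v k) q = R (v i) (v k) q'" using mid[OF lt(2), of "(v i, v k)" q q'] pqr by simp
    then show "R p q r = R p' q' r'"
      using main[OF pqr(1-3)] main[OF pqr(4-6)] by simp
  qed
qed

subsection \<open>Representatives and independent sets in the parts\<close>

definition complete_on :: "'a set \<Rightarrow> bool" where
  "complete_on S \<longleftrightarrow> (\<forall>p\<in>S. \<forall>q\<in>S. \<forall>r\<in>S. p \<noteq> q \<and> p \<noteq> r \<and> q \<noteq> r \<longrightarrow> R p q r)"

definition empty_on :: "'a set \<Rightarrow> bool" where
  "empty_on S \<longleftrightarrow> (\<forall>p\<in>S. \<forall>q\<in>S. \<forall>r\<in>S. p \<noteq> q \<and> p \<noteq> r \<and> q \<noteq> r \<longrightarrow> \<not> R p q r)"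

lemma empty_on_subset: "empty_on S \<Longrightarrow> T \<subseteq> S \<Longrightarrow> empty_on T"
  unfolding empty_on_def by blast

lemma constant_on_triples:
  fixes f :: "nat \<Rightarrow> 'a"
  assumes U: "f ` I \<subseteq> U" and inj: "inj_on f I"
    and c: "\<And>i k l. \<lbrakk>i \<in> I; k \<in> I; l \<in> I; i < k; k < l\<rbrakk> \<Longrightarrow> R (f i) (f k) (f l) \<longleftrightarrow> c"
    and pqr: "p \<in> f ` I" "q \<in> f ` I" "r \<in> f ` I" "p \<noteq> q" "p \<noteq> r" "q \<noteq> r"
  shows "R p q r \<longleftrightarrow> c"
proof -
  obtain i k l where ikl: "i \<in> I" "k \<in> I" "l \<in> I" "p = f i" "q = f k" "r = f l"
    using pqr(1-3) by blast
  have ne: "i \<noteq> k" "i \<noteq> l" "k \<noteq> l" using ikl pqr(4-6) by auto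
  have pU: "p \<in> U" "q \<in> U" "r \<in> U" using U pqr(1-3) by blast+
  note perm = R_perm[OF pU pqr(4-6)]
  consider "i < k" "k < l" | "i < l" "l < k" | "k < i" "i < l" | "k < l" "l < i" | "l < i" "i < k" | "l < k" "k < i"
    using ne by linarith
  then show ?thesis
  proof cases
    case 1 then show ?thesis using c[of i k l] ikl by simp
  next
    case 2 then show ?thesis using c[of i l k] ikl perm(2) by simp
  next
    case 3 then show ?thesis using c[of k i l] ikl perm(1) by simp
  next
    case 4 then show ?thesis using c[of k l i] ikl perm(3) by simp
  next
    case 5 then show ?thesis using c[of l i k] ikl perm(4) by simp
  next
    case 6 then show ?thesis using c[of l k i] ikl perm(5) by simp
  qed
qed

text \<open>Each of the \<open>T\<close> steps pays \<open>C * (T + 1)\<close> bits for a cut and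
  one bit for removing the chosen point.\<close>

definition chain_cost :: "nat \<Rightarrow> nat" where
  "chain_cost T = T * (C * (T + 1) + 1)"

text \<open>The end-homogeneous sequence of Erdos and Rado: a point \<open>p\<close> is moved from
  the reservoir \<open>S\<close> to the sequence, and the rest of \<open>S\<close> is cut against
  the pairs formed by an earlier point and \<open>p\<close>. There are at most
  \<open>j < 2 ^ T\<close> of these, so precision \<open>T\<close> suffices. The number
  \<open>u\<close> of bits left in the reservoir is generalised for the induction.\<close>

lemma erdos_rado_chain:
  assumes W: "W \<subseteq> U" "finite W" and "2 ^ (j * (C * (T + 1) + 1) + u) \<le> card W" and "j \<le> T"
  shows "\<exists>f \<chi> S. inj_on f {..<j} \<and> f ` {..<j} \<subseteq> W \<and> S \<subseteq> W \<and> f ` {..<j} \<inter> S = {} \<and> 2 ^ u \<le> card S \<and>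
    (\<forall>i k. i < k \<and> k < j \<longrightarrow>
       (\<forall>l. k < l \<and> l < j \<longrightarrow> R (f i) (f k) (f l) = \<chi> i k) \<and> (\<forall>q\<in>S. R (f i) (f k) q = \<chi> i k))"
  using assms(3,4)
proof (induction j arbitrary: u)
  case 0
  then show ?case using W by auto
next
  case (Suc j)
  let ?c = "C * (T + 1)"
  have "2 ^ (j * (?c + 1) + (?c + u + 1)) \<le> card W" using Suc.prems(1) by (simp add: algebra_simps)
  from Suc.IH[OF this] Suc.prems(2)
  obtain f \<chi> S where f: "inj_on f {..<j}" "f ` {..<j} \<subseteq> W" and S: "S \<subseteq> W" "f ` {..<j} \<inter> S = {}"
    and cardS: "2 ^ (?c + u + 1) \<le> card S"
    and \<chi>: "\<forall>i k. i < k \<and> k < j \<longrightarrow>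
       (\<forall>l. k < l \<and> l < j \<longrightarrow> R (f i) (f k) (f l) = \<chi> i k) \<and> (\<forall>q\<in>S. R (f i) (f k) q = \<chi> i k)"
    by (elim meta_impE exE conjE) simp
  have "S \<noteq> {}" using cardS by auto
  then obtain p where p: "p \<in> S" by blast
  have fin: "finite S" using S(1) W(2) finite_subset by blast
  define F where "F = (\<lambda>i. (f i, p)) ` {..<j}"
  have "f i \<in> U" if "i < j" for i using f(2) W(1) that by blast
  moreover have "p \<in> U" using p S(1) W(1) by blast
  ultimately have FU: "F \<subseteq> U \<times> U" by (auto simp: F_def)
  have "card F \<le> j" using card_image_le[of "{..<j}" "\<lambda>i. (f i, p)"] by (simp add: F_def)
  also have "j < 2 ^ T" using Suc.prems(2) less_exp[of T] by linarith
  finally have cardF: "card F < 2 ^ T" .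
  have finF: "finite F" by (simp add: F_def)
  have X: "S - {p} \<subseteq> U" "finite (S - {p})" using S(1) W fin by auto
  have "card (S - {p}) = card S - 1" using p fin by simp
  \<comment> \<open>The spare bit covers the loss of the point \<open>p\<close>.\<close>
  moreover have "(2::nat) ^ (?c + u) + 1 \<le> 2 ^ (?c + u + 1)" by simp
  ultimately have "2 ^ (?c + u) \<le> card (S - {p})" using cardS by linarith
  then obtain A where A: "A \<subseteq> S - {p}" "card A = 2 ^ u"
    and AF: "\<And>a b x z. \<lbrakk>(a, b) \<in> F; x \<in> A; z \<in> A\<rbrakk> \<Longrightarrow> R a b x = R a b z"
    using cell[OF FU finF cardF X] by blast
  have "A \<noteq> {}" using A(2) by auto
  then obtain a where a: "a \<in> A" by blast
  let ?f = "f(j := p)"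
  define \<chi>' where "\<chi>' i k = (if k = j then R (f i) p a else \<chi> i k)" for i k
  have "inj_on ?f {..<Suc j}"
    using f(1) S(2) p unfolding lessThan_Suc by (auto simp: inj_on_def)
  moreover have "?f ` {..<Suc j} \<subseteq> W"
    using f(2) p S(1) unfolding lessThan_Suc by auto
  moreover have "A \<subseteq> W" using A(1) S(1) by blast
  moreover have "?f ` {..<Suc j} \<inter> A = {}"
    using S(2) A(1) unfolding lessThan_Suc by auto
  moreover have "2 ^ u \<le> card A" using A(2) by simp
  moreover have "(\<forall>l. k < l \<and> l < Suc j \<longrightarrow> R (?f i) (?f k) (?f l) = \<chi>' i k) \<and> (\<forall>q\<in>A. R (?f i) (?f k) q = \<chi>' i k)"
    if ik: "i < k \<and> k < Suc j" for i k
  proof (cases "k = j")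
    case True
    have "R (f i) p q = R (f i) p a" if "q \<in> A" for q
      by (rule AF) (use ik True that a in \<open>auto simp: F_def\<close>)
    then show ?thesis using True ik by (auto simp: \<chi>'_def)
  next
    case False
    then have k: "k < j" using ik by simp
    then have *: "\<And>l. k < l \<and> l < j \<Longrightarrow> R (f i) (f k) (f l) = \<chi> i k" "\<And>q. q \<in> S \<Longrightarrow> R (f i) (f k) q = \<chi> i k"
      using \<chi> ik by blast+
    have "R (?f i) (?f k) (?f l) = \<chi>' i k" if "k < l \<and> l < Suc j" for l
    proof (cases "l = j")
      case True
      then show ?thesis using *(2)[OF p] k ik by (auto simp: \<chi>'_def)
    next
      case False
      then show ?thesis using *(1)[of l] that k ik by (auto simp: \<chi>'_def)
    qed
    moreover have "R (?f i) (?f k) q = \<chi>' i k" if "q \<in> A" for q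
      using *(2)[of q] that A(1) k ik by (auto simp: \<chi>'_def)
    ultimately show ?thesis by blast
  qed
  ultimately show ?case by (intro exI[of _ ?f] exI[of _ \<chi>'] exI[of _ A] conjI allI impI) blast+
qed

text \<open>In an end-homogeneous sequence the first two indices decide each triple, so cliques and
  independent sets of the graph \<open>G\<close> on the indices become complete and empty sets of
  points; \<open>m ^ s\<close> indices are enough for the graph.\<close>

lemma erdos_rado:
  assumes W: "W \<subseteq> U" "finite W" and card: "2 ^ chain_cost (m ^ s) \<le> card W"
  shows "(\<exists>S\<subseteq>W. card S = s \<and> complete_on S) \<or> (\<exists>S\<subseteq>W. card S = m \<and> empty_on S)"
proof -
  define T where "T = m ^ s"
  have "2 ^ (T * (C * (T + 1) + 1) + 0) \<le> card W" using card by (simp add: chain_cost_def T_def)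
  from erdos_rado_chain[OF W this order_refl]
  obtain f \<chi> where f: "inj_on f {..<T}" "f ` {..<T} \<subseteq> W"
    and \<chi>: "\<And>i k l. \<lbrakk>i < k; k < l; l < T\<rbrakk> \<Longrightarrow> R (f i) (f k) (f l) = \<chi> i k"
    by (elim exE conjE) (metis less_trans)
  define G where "G i k = \<chi> (min i k) (max i k)" for i k
  have "symp G" by (auto simp: symp_def G_def min.commute max.commute)
  from ramsey_power_bound[of "{..<T}" m s, OF _ _ this]
  consider I where "I \<subseteq> {..<T}" "card I = s" "pairwise G I"
    | I where "I \<subseteq> {..<T}" "card I = m" "pairwise (\<lambda>i k. \<not> G i k) I"
    by (auto simp: T_def)
  then show ?thesis
  proof cases
    case 1
    have inj: "inj_on f I" using f(1) 1(1) inj_on_subset by blast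
    have sub: "f ` I \<subseteq> W" using f(2) 1(1) by blast
    have "R (f i) (f k) (f l) \<longleftrightarrow> True" if "i \<in> I" "k \<in> I" "l \<in> I" "i < k" "k < l" for i k l
    proof -
      have "G i k" using 1(3) that by (simp add: pairwise_def)
      then show ?thesis using \<chi>[of i k l] that 1(1) by (auto simp: G_def)
    qed
    from constant_on_triples[OF subset_trans[OF sub W(1)] inj this]
    have "complete_on (f ` I)" unfolding complete_on_def by blast
    then show ?thesis using sub card_image[OF inj] 1(2) by blast
  next
    case 2
    have inj: "inj_on f I" using f(1) 2(1) inj_on_subset by blast
    have sub: "f ` I \<subseteq> W" using f(2) 2(1) by blast
    have "R (f i) (f k) (f l) \<longleftrightarrow> False" if "i \<in> I" "k \<in> I" "l \<in> I" "i < k" "k < l" for i k l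
    proof -
      have "\<not> G i k" using 2(3) that by (simp add: pairwise_def)
      then show ?thesis using \<chi>[of i k l] that 2(1) by (auto simp: G_def)
    qed
    from constant_on_triples[OF subset_trans[OF sub W(1)] inj this]
    have "empty_on (f ` I)" unfolding empty_on_def by blast
    then show ?thesis using sub card_image[OF inj] 2(2) by blast
  qed
qed

text \<open>\<open>X\<close> is halved. \<open>cell\<close> cannot cut the first half against
  \<open>X2 \<times> Q\<close>, a family that grows with \<open>X\<close>, but averaging can: with
  precision \<open>\<mu> + 1\<close> at most half of the points of \<open>X2\<close> lie in an
  exceptional pair. For the others \<open>R b a q\<close> does not depend on \<open>a\<close>, so
  one \<open>a0\<close> represents \<open>A\<close>, and a second cut deals with the few pairs
  \<open>(a0, q)\<close>. Two bits go to the halving and to the discarded points.\<close>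

lemma homogeneous_pair:
  assumes Q: "Q \<subseteq> U" "finite Q" "card Q \<le> 2 ^ \<mu>" and X: "X \<subseteq> U" "finite X" "X \<inter> Q = {}"
    and card: "2 ^ (u + (C * (\<mu> + 2) + 2)) \<le> card X"
  shows "\<exists>A B. A \<subseteq> X \<and> B \<subseteq> X \<and> A \<inter> B = {} \<and> 2 ^ u \<le> card A \<and> 2 ^ u \<le> card B \<and>
    (\<forall>q\<in>Q. \<exists>c. \<forall>a\<in>A. \<forall>b\<in>B. R b a q = c)"
proof -
  let ?h = "C * (\<mu> + 2)"
  have "2 * 2 ^ (u + ?h + 1) \<le> card X" using card by (simp add: add.assoc)
  from ex_disjoint_subsets[OF X(2) this]
  obtain P where P: "\<forall>i<(2::nat). P i \<subseteq> X \<and> card (P i) = 2 ^ (u + ?h + 1)"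
    "\<forall>i<(2::nat). \<forall>j<(2::nat). i \<noteq> j \<longrightarrow> P i \<inter> P j = {}" by (elim exE conjE)
  define X1 where "X1 = P 0"
  define X2 where "X2 = P 1"
  have X1: "X1 \<subseteq> X" "card X1 = 2 ^ (u + ?h + 1)" and X2: "X2 \<subseteq> X" "card X2 = 2 ^ (u + ?h + 1)"
    using P(1) by (simp_all add: X1_def X2_def)
  have disj: "X1 \<inter> X2 = {}" using P(2) by (simp add: X1_def X2_def)
  have fin: "finite X1" "finite X2" using X1(1) X2(1) X(2) finite_subset by blast+
  have sub: "X2 \<times> Q \<subseteq> U \<times> U" "X1 \<subseteq> U" using X1(1) X2(1) X(1) Q(1) by auto
  let ?bad = "\<lambda>A. {f \<in> X2 \<times> Q. \<exists>x\<in>A. \<exists>z\<in>A. R (fst f) (snd f) x \<noteq> R (fst f) (snd f) z}"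
  obtain A where A: "A \<subseteq> X1" "card X1 \<le> 2 ^ (C * (\<mu> + 1 + 1)) * card A"
    "card (?bad A) * 2 ^ (\<mu> + 1) \<le> card (X2 \<times> Q)"
    using cutting[OF sub(1) finite_cartesian_product[OF fin(2) Q(2)] sub(2) fin(1), of "\<mu> + 1"] by blast
  have "2 ^ ?h * 2 ^ (u + 1) \<le> 2 ^ ?h * card A" using A(2) X1(2) by (simp add: power_add ac_simps)
  then have cardA: "2 ^ (u + 1) \<le> card A" by simp
  then have "A \<noteq> {}" by auto
  then obtain a0 where a0: "a0 \<in> A" by blast
  \<comment> \<open>The number of exceptional pairs is at most
    \<open>card X2 * card Q / 2^(\<mu> + 1)\<close>, hence at most half of
    \<open>card X2\<close>.\<close>
  define B0 where "B0 = X2 - fst ` ?bad A"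
  have finbad: "finite (?bad A)" by (rule finite_subset[OF _ finite_cartesian_product[OF fin(2) Q(2)]]) blast
  have "card (X2 \<times> Q) \<le> card X2 * 2 ^ \<mu>"
    unfolding card_cartesian_product by (rule mult_le_mono2[OF Q(3)])
  from le_trans[OF A(3) this]
  have "card (?bad A) * 2 ^ (\<mu> + 1) \<le> card X2 * 2 ^ \<mu>" .
  then have "card (?bad A) * 2 \<le> card X2" by simp
  moreover have "card X2 - card (fst ` ?bad A) \<le> card B0"
    unfolding B0_def by (rule diff_card_le_card_Diff) (use finbad in simp)
  moreover have "card (fst ` ?bad A) \<le> card (?bad A)" using finbad by (rule card_image_le)
  ultimately have "card X2 \<le> card B0 * 2" by linarith
  then have cardB0: "2 ^ (C * (\<mu> + 1 + 1) + u) \<le> card B0" using X2(2) by (simp add: power_add ac_simps)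
  have B0: "B0 \<subseteq> U" "finite B0" using X2(1) X(1) fin(2) by (auto simp: B0_def)
  have a0U: "a0 \<in> U" "a0 \<in> X" using a0 A(1) X1(1) X(1) by blast+
  have F: "{a0} \<times> Q \<subseteq> U \<times> U" "finite ({a0} \<times> Q)" "card ({a0} \<times> Q) < 2 ^ (\<mu> + 1)"
    using a0U Q by (auto simp: card_cartesian_product_singleton le_less_trans)
  obtain B where B: "B \<subseteq> B0" "card B = 2 ^ u"
    and BF: "\<And>p q x z. \<lbrakk>(p, q) \<in> {a0} \<times> Q; x \<in> B; z \<in> B\<rbrakk> \<Longrightarrow> R p q x = R p q z"
    using cell[OF F B0 cardB0] by blast
  have BX2: "B \<subseteq> X2" using B(1) by (auto simp: B0_def)
  have "\<exists>c. \<forall>a\<in>A. \<forall>b\<in>B. R b a q = c" if q: "q \<in> Q" for q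
  proof -
    have "B \<noteq> {}" using B(2) by auto
    then obtain b0 where b0: "b0 \<in> B" by blast
    have "R b a q = R a0 q b0" if ab: "a \<in> A" "b \<in> B" for a b
    proof -
      have U: "a \<in> U" "b \<in> U" "q \<in> U" using ab q A(1) BX2 X1(1) X2(1) X(1) Q(1) by blast+
      have ne: "a \<noteq> b" "a0 \<noteq> b" "a \<noteq> q" "b \<noteq> q" "a0 \<noteq> q"
        using ab a0 q A(1) BX2 disj X1(1) X2(1) X(3) by blast+
      have "b \<notin> fst ` ?bad A" using ab(2) B(1) by (auto simp: B0_def)
      then have "(b, q) \<notin> ?bad A" by force
      then have *: "R b q a = R b q a0" using ab a0 q BX2 by auto
      have "R b a q = R b q a" using swap23[of b a q] U ne by auto
      also have "\<dots> = R b q a0" by (rule *)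
      also have "\<dots> = R a0 q b" using R_perm(5)[of b q a0] U a0U ne by auto
      also have "\<dots> = R a0 q b0" by (rule BF) (use q ab b0 in auto)
      finally show ?thesis .
    qed
    then show ?thesis by blast
  qed
  moreover have "2 ^ u \<le> card A" using cardA by simp
  moreover have "A \<inter> B = {}" using A(1) BX2 disj by blast
  ultimately show ?thesis using A(1) X1(1) BX2 X2(1) B(2) by (metis order_refl subset_trans)
qed

text \<open>To the graphs \<open>R p p' q\<close> for \<open>q\<close> in \<open>Q\<close> one adds
  the graph \<open>None\<close> of the pairs that are edges for no \<open>q\<close>. A homogeneous
  pair of sets is complete for one of these graphs, so \<open>cograph_product\<close> applies;
  bounding the other factors by \<open>2 ^ l\<close> isolates the set for
  \<open>None\<close>.\<close>

lemma independent_in_part: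
  assumes Q: "Q \<subseteq> U" "finite Q" "card Q \<le> 2 ^ \<mu>" and X: "X \<subseteq> U" "finite X" "X \<inter> Q = {}"
    and card: "2 ^ (k * (C * (\<mu> + 2) + 2)) \<le> card X"
    and small: "\<forall>W q. W \<subseteq> X \<and> q \<in> Q \<and> pairwise (\<lambda>p p'. R p p' q) W \<longrightarrow> card W \<le> 2 ^ l"
  shows "\<exists>I\<subseteq>X. pairwise (\<lambda>p p'. \<forall>q\<in>Q. \<not> R p p' q) I \<and> 2 ^ k \<le> card I * 2 ^ (l * 2 ^ \<mu>)"
proof -
  define O' where "O' = insert None (Some ` Q)"
  define G where "G w p p' = (case w of None \<Rightarrow> \<forall>q\<in>Q. \<not> R p p' q | Some q \<Rightarrow> R p p' q)" for w p p'
  have finO: "finite O'" using Q(2) by (simp add: O'_def)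
  have split: "\<exists>A B w. A \<subseteq> Y \<and> B \<subseteq> Y \<and> A \<inter> B = {} \<and> 2 ^ u \<le> card A \<and> 2 ^ u \<le> card B \<and> w \<in> O' \<and>
        (\<forall>a\<in>A. \<forall>b\<in>B. G w a b \<and> G w b a)"
    if Y: "Y \<subseteq> X" "2 ^ (u + (C * (\<mu> + 2) + 2)) \<le> card Y" for Y u
  proof -
    have Y': "Y \<subseteq> U" "finite Y" "Y \<inter> Q = {}" using Y(1) X finite_subset by blast+
    from homogeneous_pair[OF Q Y' Y(2)]
    obtain A B where AB: "A \<subseteq> Y" "B \<subseteq> Y" "A \<inter> B = {}" "2 ^ u \<le> card A" "2 ^ u \<le> card B"
      and c: "\<forall>q\<in>Q. \<exists>c. \<forall>a\<in>A. \<forall>b\<in>B. R b a q = c" by (elim exE conjE)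
    have sym: "R a b q = R b a q" if "a \<in> A" "b \<in> B" "q \<in> Q" for a b q
      using swap12[of a b q] that AB(1-3) Y' Q(1) by blast
    have "\<exists>w\<in>O'. \<forall>a\<in>A. \<forall>b\<in>B. G w a b \<and> G w b a"
    proof (cases "\<exists>q\<in>Q. \<forall>a\<in>A. \<forall>b\<in>B. R b a q")
      case True
      then obtain q where q: "q \<in> Q" "\<forall>a\<in>A. \<forall>b\<in>B. R b a q" by blast
      then have "\<forall>a\<in>A. \<forall>b\<in>B. G (Some q) a b \<and> G (Some q) b a"
        unfolding G_def option.case using sym by blast
      then show ?thesis using q(1) by (auto simp: O'_def)
    next
      case False
      then have "\<forall>q\<in>Q. \<forall>a\<in>A. \<forall>b\<in>B. \<not> R b a q" using c by metis
      then have "\<forall>a\<in>A. \<forall>b\<in>B. G None a b \<and> G None b a"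
        unfolding G_def option.case using sym by blast
      then show ?thesis by (auto simp: O'_def)
    qed
    then show ?thesis using AB by blast
  qed
  obtain S where S: "\<forall>w\<in>O'. S w \<subseteq> X \<and> pairwise (G w) (S w)" "2 ^ k \<le> (\<Prod>w\<in>O'. card (S w))"
    using cograph_product[OF finO split order_refl X(2) card] by blast
  have "(\<Prod>w\<in>O'. card (S w)) = card (S None) * (\<Prod>w\<in>Some ` Q. card (S w))"
    using Q(2) by (simp add: O'_def)
  also have "(\<Prod>w\<in>Some ` Q. card (S w)) = (\<Prod>q\<in>Q. card (S (Some q)))"
    by (simp add: prod.reindex)
  also have "\<dots> \<le> (\<Prod>q\<in>Q. 2 ^ l)"
  proof (intro prod_mono conjI)
    fix q assume q: "q \<in> Q"
    then have "S (Some q) \<subseteq> X" "pairwise (G (Some q)) (S (Some q))" using S(1) by (auto simp: O'_def)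
    then show "card (S (Some q)) \<le> 2 ^ l" using small[rule_format, of "S (Some q)" q] q by (simp add: G_def pairwise_def)
  qed simp
  also have "\<dots> = 2 ^ (l * card Q)" by (simp add: power_mult)
  also have "\<dots> \<le> 2 ^ (l * 2 ^ \<mu>)" using Q(3) by (intro power_increasing mult_le_mono2) auto
  finally have "2 ^ k \<le> card (S None) * 2 ^ (l * 2 ^ \<mu>)"
    using S(2) by (meson le_trans mult_le_mono2)
  moreover have "S None \<subseteq> X" "pairwise (\<lambda>p p'. \<forall>q\<in>Q. \<not> R p p' q) (S None)"
    using S(1) by (simp_all add: O'_def G_def pairwise_def)
  ultimately show ?thesis by blast
qed

subsection \<open>The recursion\<close>

text \<open>The factor in the exponent lost per round: a part from which \<open>2 ^ k\<close> points
  are to survive is given \<open>2 * k\<close> splits of \<open>C * (\<mu> + 2) + 2\<close> bits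
  each, and \<open>parts_factor\<close> converts the bits of a part into those of the whole
  set.\<close>

definition shrink_factor :: "nat \<Rightarrow> nat" where
  "shrink_factor \<mu> = 2 * parts_factor * (C * (\<mu> + 2) + 2)"

text \<open>One round of the iteration. Homogeneity lets the representatives decide about whole
  parts: an empty set of representatives excludes the triples of type 1+1+1, and thinning against
  the representatives of the other parts excludes those of type 2+1. Of the \<open>2 * k\<close>
  bits gained by splitting, at most \<open>l * 2 ^ \<mu> \<le> k\<close> are lost to
  cliques.\<close>

lemma cross_free_parts:
  assumes V: "V \<subseteq> U" "finite V"
    and no_clique: "\<not> (\<exists>S\<subseteq>V. card S = s \<and> complete_on S)"
    and small: "\<forall>W q. W \<subseteq> V \<and> q \<in> V \<and> q \<notin> W \<and> pairwise (\<lambda>p p'. R p p' q) W \<longrightarrow> card W \<le> 2 ^ l"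
    and k: "1 \<le> k" "l * 2 ^ \<mu> \<le> k" "chain_cost ((2 ^ \<mu>) ^ s) \<le> k"
    and X: "X \<subseteq> V" "2 ^ (shrink_factor \<mu> * k) \<le> card X"
  shows "\<exists>(J :: nat set) Y. finite J \<and> card J = 2 ^ \<mu> \<and> (\<forall>i\<in>J. Y i \<subseteq> X \<and> 2 ^ k \<le> card (Y i)) \<and>
    (\<forall>i\<in>J. \<forall>j\<in>J. i \<noteq> j \<longrightarrow> Y i \<inter> Y j = {}) \<and>
    (\<forall>i\<in>J. \<forall>j\<in>J. \<forall>m\<in>J. \<not> (i = j \<and> j = m) \<longrightarrow>
       (\<forall>p\<in>Y i. \<forall>q\<in>Y j. \<forall>r\<in>Y m. p \<noteq> q \<and> p \<noteq> r \<and> q \<noteq> r \<longrightarrow> \<not> R p q r))"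
proof -
  define c where "c = C * (\<mu> + 2) + 2"
  \<comment> \<open>The same \<open>b\<close> measures the size and the number of the parts. It is
    large enough for \<open>2 * k\<close> splits of a part and, because of \<open>k \<le> b\<close>,
    for the Erdos-Rado argument on the representatives.\<close>
  define b where "b = 2 * k * c"
  have XU: "X \<subseteq> U" "finite X" using X(1) V finite_subset by blast+
  have "k * 1 \<le> k * (2 * c)" by (intro mult_le_mono2) (simp add: c_def)
  then have kb: "k \<le> b" by (simp add: b_def mult.commute mult.left_commute)
  then have b1: "1 \<le> b" using k(1) by simp
  have "parts_factor * b = shrink_factor \<mu> * k" by (simp only: b_def c_def shrink_factor_def mult.assoc mult.left_commute[of k] mult.commute[of k])
  then have cardX: "2 ^ (parts_factor * b) \<le> card X" using X(2) by simp
  obtain P where P: "\<And>i :: nat. i < 2 ^ b \<Longrightarrow> P i \<subseteq> X \<and> card (P i) = 2 ^ b"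
    and disj: "\<And>i j. \<lbrakk>i < 2 ^ b; j < 2 ^ b; i \<noteq> j\<rbrakk> \<Longrightarrow> P i \<inter> P j = {}"
    and two: "\<And>i j p p' q q'. \<lbrakk>i < 2 ^ b; j < 2 ^ b; i \<noteq> j; p \<in> P i; p' \<in> P i; q \<in> P j; q' \<in> P j\<rbrakk>
       \<Longrightarrow> R p p' q = R p p' q'"
    and three: "\<And>i j k p q r p' q' r'. \<lbrakk>i < j; j < k; k < 2 ^ b; p \<in> P i; q \<in> P j; r \<in> P k;
       p' \<in> P i; q' \<in> P j; r' \<in> P k\<rbrakk> \<Longrightarrow> R p q r = R p' q' r'"
    using homogeneous_parts[OF XU b1 cardX] by blast
  define v where "v i = (SOME p. p \<in> P i)" for i
  have v: "v i \<in> P i" if "i < 2 ^ b" for i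
  proof -
    have "card (P i) \<noteq> 0" using P[OF that] by simp
    then show ?thesis unfolding v_def some_in_eq by force
  qed
  have inj: "inj_on v {..<2 ^ b}"
  proof (rule inj_onI, rule ccontr)
    fix i j assume "i \<in> {..<2 ^ b}" "j \<in> {..<2 ^ b}" "v i = v j" "i \<noteq> j"
    then show False using v[of i] v[of j] disj[of i j] by auto
  qed
  define W where "W = v ` {..<2 ^ b}"
  have WX: "W \<subseteq> X" using v P by (auto simp: W_def)
  then have W: "W \<subseteq> U" "finite W" using XU finite_subset by blast+
  have "chain_cost ((2 ^ \<mu>) ^ s) \<le> b" using k(3) kb by simp
  then have "2 ^ chain_cost ((2 ^ \<mu>) ^ s) \<le> (2::nat) ^ b" by (rule power_increasing) simp
  also have "\<dots> = card W" by (simp add: W_def card_image[OF inj])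
  finally have cardW: "2 ^ chain_cost ((2 ^ \<mu>) ^ s) \<le> card W" .
  have "\<not> (\<exists>S\<subseteq>W. card S = s \<and> complete_on S)" using no_clique subset_trans[OF subset_trans[OF _ WX] X(1)] by blast
  then obtain S where S: "S \<subseteq> W" "card S = 2 ^ \<mu>" "empty_on S" using erdos_rado[OF W cardW] by blast
  define J where "J = {i. i < 2 ^ b \<and> v i \<in> S}"
  have J: "i < 2 ^ b" "v i \<in> S" if "i \<in> J" for i using that by (simp_all add: J_def)
  have finJ: "finite J" by (simp add: J_def)
  have "v ` J = S" using S(1) by (auto simp: J_def W_def)
  moreover have injJ: "inj_on v J" using inj by (rule inj_on_subset) (auto simp: J_def)
  ultimately have cardJ: "card J = 2 ^ \<mu>" using S(2) card_image by metis
  have "\<forall>i. \<exists>Y. i \<in> J \<longrightarrow> Y \<subseteq> P i \<and> pairwise (\<lambda>p p'. \<forall>q\<in>v ` (J - {i}). \<not> R p p' q) Y \<and> 2 ^ k \<le> card Y"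
  proof (intro allI, cases)
    fix i assume i: "i \<in> J"
    let ?Q = "v ` (J - {i})"
    have "v j \<in> X" if "j \<in> J" for j using v[OF J(1)[OF that]] P[OF J(1)[OF that]] by blast
    then have QX: "?Q \<subseteq> X" by blast
    have "card ?Q \<le> card (J - {i})" using finJ by (intro card_image_le) simp
    also have "\<dots> \<le> card J" using finJ by (intro card_mono) auto
    finally have Q: "?Q \<subseteq> U" "finite ?Q" "card ?Q \<le> 2 ^ \<mu>" using QX XU(1) finJ cardJ by auto
    have Pi: "P i \<subseteq> X" "card (P i) = 2 ^ b" using P[OF J(1)[OF i]] by auto
    have PQ: "P i \<inter> ?Q = {}"
    proof -
      have "v j \<notin> P i" if "j \<in> J - {i}" for j
        using disj[of j i] v[of j] J(1)[of j] J(1)[OF i] that by blast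
      then show ?thesis by blast
    qed
    have Pi': "P i \<subseteq> U" "finite (P i)" using Pi(1) XU finite_subset by blast+
    have cP: "2 ^ (2 * k * (C * (\<mu> + 2) + 2)) \<le> card (P i)" using Pi(2) by (simp add: b_def c_def)
    have "\<forall>Z q. Z \<subseteq> P i \<and> q \<in> ?Q \<and> pairwise (\<lambda>p p'. R p p' q) Z \<longrightarrow> card Z \<le> 2 ^ l"
    proof (intro allI impI, elim conjE)
      fix Z q assume Z: "Z \<subseteq> P i" "q \<in> ?Q" "pairwise (\<lambda>p p'. R p p' q) Z"
      then have "Z \<subseteq> V" "q \<in> V" "q \<notin> Z" using Pi(1) X(1) QX PQ by blast+
      then show "card Z \<le> 2 ^ l" using small Z(3) by blast
    qed
    from independent_in_part[OF Q Pi' PQ cP this]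
    obtain I where I: "I \<subseteq> P i" "pairwise (\<lambda>p p'. \<forall>q\<in>?Q. \<not> R p p' q) I"
      "2 ^ (2 * k) \<le> card I * 2 ^ (l * 2 ^ \<mu>)" by blast
    have "(2::nat) ^ (l * 2 ^ \<mu>) \<le> 2 ^ k" using k(2) by (rule power_increasing) simp
    then have "2 ^ (2 * k) \<le> card I * 2 ^ k" using I(3) by (meson le_trans mult_le_mono2)
    then have "2 ^ k * 2 ^ k \<le> card I * 2 ^ k" by (simp only: mult_2 power_add)
    then have "2 ^ k \<le> card I" by simp
    then show "\<exists>Y. i \<in> J \<longrightarrow> Y \<subseteq> P i \<and> pairwise (\<lambda>p p'. \<forall>q\<in>v ` (J - {i}). \<not> R p p' q) Y \<and> 2 ^ k \<le> card Y"
      using I by blast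
  qed blast
  from choice[OF this] obtain Y where "\<forall>i. i \<in> J \<longrightarrow> Y i \<subseteq> P i \<and>
    pairwise (\<lambda>p p'. \<forall>q\<in>v ` (J - {i}). \<not> R p p' q) (Y i) \<and> 2 ^ k \<le> card (Y i)" ..
  then have Y: "Y i \<subseteq> P i" "pairwise (\<lambda>p p'. \<forall>q\<in>v ` (J - {i}). \<not> R p p' q) (Y i)" "2 ^ k \<le> card (Y i)"
    if "i \<in> J" for i using that by blast+
  have YX: "Y i \<subseteq> X" if "i \<in> J" for i using Y(1)[OF that] P[OF J(1)[OF that]] by blast
  have disjY: "Y i \<inter> Y j = {}" if "i \<in> J" "j \<in> J" "i \<noteq> j" for i j
    using disj[OF J(1)[OF that(1)] J(1)[OF that(2)] that(3)] Y(1)[OF that(1)] Y(1)[OF that(2)] by blast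
  \<comment> \<open>By \<open>two\<close> the point \<open>q\<close> may be replaced by the
    representative \<open>v j\<close>, against which \<open>Y i\<close> has been thinned.\<close>
  have pair: "\<not> R p p' q" if ij: "i \<in> J" "j \<in> J" "i \<noteq> j" and pq: "p \<in> Y i" "p' \<in> Y i" "q \<in> Y j" "p \<noteq> p'" for i j p p' q
  proof -
    have "p \<in> P i" "p' \<in> P i" "q \<in> P j" using Y(1) ij pq by blast+
    then have "R p p' q = R p p' (v j)" using two ij J(1) v by blast
    moreover have "v j \<in> v ` (J - {i})" using ij by blast
    ultimately show ?thesis using Y(2)[OF ij(1)] pq unfolding pairwise_def by blast
  qed
  have cross: "\<not> R p q r"
    if ijm: "i \<in> J" "j \<in> J" "m \<in> J" "\<not> (i = j \<and> j = m)" and pqr: "p \<in> Y i" "q \<in> Y j" "r \<in> Y m"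
      and ne: "p \<noteq> q" "p \<noteq> r" "q \<noteq> r" for i j m p q r
  proof -
    have inU: "p \<in> U" "q \<in> U" "r \<in> U" using pqr YX ijm XU(1) by blast+
    consider "i = j" "j \<noteq> m" | "i = m" "j \<noteq> m" | "j = m" "i \<noteq> j" | "i \<noteq> j" "j \<noteq> m" "i \<noteq> m"
      using ijm(4) by blast
    then show ?thesis
    proof cases
      case 1
      then show ?thesis using pair[of j m p q r] ijm pqr ne by blast
    next
      case 2
      then have "\<not> R p r q" using pair[of m j p r q] ijm pqr ne by blast
      then show ?thesis using swap23[OF inU ne] by simp
    next
      case 3
      then have "\<not> R q r p" using pair[of m i q r p] ijm pqr ne by blast
      then show ?thesis using R_perm(3)[OF inU ne] by simp
    next
      case 4
      \<comment> \<open>A system of representatives passing through the given points; by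
        \<open>three\<close> its increasing triples behave like those of \<open>v\<close>, which lie
        in the empty set \<open>S\<close>.\<close>
      define f where "f x = (if x = i then p else if x = j then q else r)" for x
      have fP: "f x \<in> P x" if "x \<in> {i, j, m}" for x
        using that 4 pqr Y(1) ijm by (auto simp: f_def)
      have "R (f x) (f y) (f z) \<longleftrightarrow> False"
        if xyz: "x \<in> {i, j, m}" "y \<in> {i, j, m}" "z \<in> {i, j, m}" "x < y" "y < z" for x y z
      proof -
        have xJ: "x \<in> J" "y \<in> J" "z \<in> J" using xyz ijm by auto
        have "R (f x) (f y) (f z) = R (v x) (v y) (v z)"
          by (rule three[OF xyz(4,5)]) (use xJ J fP v xyz in auto)
        moreover have "v x \<noteq> v y" "v x \<noteq> v z" "v y \<noteq> v z"
          using inj_on_eq_iff[OF injJ xJ(1,2)] inj_on_eq_iff[OF injJ xJ(1,3)] inj_on_eq_iff[OF injJ xJ(2,3)]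
            xyz(4,5) by auto
        moreover have "v x \<in> S" "v y \<in> S" "v z \<in> S" using J(2) xJ by blast+
        ultimately show ?thesis using S(3) unfolding empty_on_def by blast
      qed
      moreover have "f ` {i, j, m} \<subseteq> U" "inj_on f {i, j, m}" using inU ne 4 by (auto simp: f_def)
      moreover have "p \<in> f ` {i, j, m}" "q \<in> f ` {i, j, m}" "r \<in> f ` {i, j, m}" using 4 by (auto simp: f_def)
      ultimately show ?thesis using constant_on_triples[of f "{i, j, m}" False p q r] ne by blast
    qed
  qed
  have "\<forall>i\<in>J. Y i \<subseteq> X \<and> 2 ^ k \<le> card (Y i)" using YX Y(3) by blast
  moreover have "\<forall>i\<in>J. \<forall>j\<in>J. i \<noteq> j \<longrightarrow> Y i \<inter> Y j = {}" using disjY by blast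
  moreover have "\<forall>i\<in>J. \<forall>j\<in>J. \<forall>m\<in>J. \<not> (i = j \<and> j = m) \<longrightarrow>
     (\<forall>p\<in>Y i. \<forall>q\<in>Y j. \<forall>r\<in>Y m. p \<noteq> q \<and> p \<noteq> r \<and> q \<noteq> r \<longrightarrow> \<not> R p q r)"
    by (intro ballI impI, elim conjE, rule cross) assumption+
  ultimately show ?thesis
    by (intro exI[of _ J] exI[of _ Y] conjI) (rule finJ, rule cardJ, assumption+)
qed

text \<open>The hypotheses about cliques concern the fixed set \<open>V\<close>, so they survive
  when \<open>X\<close> shrinks. Every triple of the union either lies in one part, where the
  induction applies, or is excluded by the round just made.\<close>

lemma empty_by_iteration:
  assumes V: "V \<subseteq> U" "finite V"
    and no_clique: "\<not> (\<exists>S\<subseteq>V. card S = s \<and> complete_on S)"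
    and small: "\<forall>W q. W \<subseteq> V \<and> q \<in> V \<and> q \<notin> W \<and> pairwise (\<lambda>p p'. R p p' q) W \<longrightarrow> card W \<le> 2 ^ l"
    and k: "1 \<le> k" "l * 2 ^ \<mu> \<le> k" "chain_cost ((2 ^ \<mu>) ^ s) \<le> k"
    and X: "X \<subseteq> V" "2 ^ (shrink_factor \<mu> ^ t * k) \<le> card X"
  shows "\<exists>I\<subseteq>X. (2 ^ \<mu>) ^ t \<le> card I \<and> empty_on I"
  using X
proof (induction t arbitrary: X)
  case 0
  then have "X \<noteq> {}" by auto
  then obtain x where "x \<in> X" by blast
  then show ?case by (intro exI[of _ "{x}"]) (auto simp: empty_on_def)
next
  case (Suc t)
  define k' where "k' = shrink_factor \<mu> ^ t * k"
  have "0 < shrink_factor \<mu>" by (simp add: shrink_factor_def parts_factor_def)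
  \<comment> \<open>The lower bounds on \<open>k\<close> are most restrictive in the innermost
    round; outer rounds have larger exponents.\<close>
  then have "k \<le> k'" by (simp add: k'_def)
  then have k': "1 \<le> k'" "l * 2 ^ \<mu> \<le> k'" "chain_cost ((2 ^ \<mu>) ^ s) \<le> k'" using k by simp_all
  have "2 ^ (shrink_factor \<mu> * k') \<le> card X" using Suc.prems(2) by (simp add: k'_def mult.assoc)
  from cross_free_parts[OF V no_clique small k' Suc.prems(1) this]
  obtain J :: "nat set" and Y where J: "finite J" "card J = 2 ^ \<mu>" and Y: "\<forall>i\<in>J. Y i \<subseteq> X \<and> 2 ^ k' \<le> card (Y i)"
    and disj: "\<forall>i\<in>J. \<forall>j\<in>J. i \<noteq> j \<longrightarrow> Y i \<inter> Y j = {}"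
    and cross: "\<forall>i\<in>J. \<forall>j\<in>J. \<forall>m\<in>J. \<not> (i = j \<and> j = m) \<longrightarrow>
       (\<forall>p\<in>Y i. \<forall>q\<in>Y j. \<forall>r\<in>Y m. p \<noteq> q \<and> p \<noteq> r \<and> q \<noteq> r \<longrightarrow> \<not> R p q r)"
    by (elim exE conjE)
  have "\<forall>i. \<exists>I. i \<in> J \<longrightarrow> I \<subseteq> Y i \<and> (2 ^ \<mu>) ^ t \<le> card I \<and> empty_on I"
  proof (intro allI, cases)
    fix i assume i: "i \<in> J"
    have "Y i \<subseteq> V" "2 ^ (shrink_factor \<mu> ^ t * k) \<le> card (Y i)"
      using Y i Suc.prems(1) unfolding k'_def by blast+
    from Suc.IH[OF this]
    show "\<exists>I. i \<in> J \<longrightarrow> I \<subseteq> Y i \<and> (2 ^ \<mu>) ^ t \<le> card I \<and> empty_on I" by blast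
  qed blast
  from choice[OF this] obtain I where "\<forall>i. i \<in> J \<longrightarrow> I i \<subseteq> Y i \<and> (2 ^ \<mu>) ^ t \<le> card (I i) \<and> empty_on (I i)" ..
  then have I: "I i \<subseteq> Y i" "(2 ^ \<mu>) ^ t \<le> card (I i)" "empty_on (I i)" if "i \<in> J" for i using that by blast+
  define Z where "Z = (\<Union>i\<in>J. I i)"
  have ZX: "Z \<subseteq> X" using I(1) Y by (auto simp: Z_def)
  have finI: "finite (I i)" if "i \<in> J" for i
    using I(1)[OF that] Y that Suc.prems(1) V(2) by (meson finite_subset subset_trans)
  have "card Z = (\<Sum>i\<in>J. card (I i))" unfolding Z_def
  proof (rule card_UN_disjoint[OF J(1)])
    show "\<forall>i\<in>J. finite (I i)" using finI by blast
    show "\<forall>i\<in>J. \<forall>j\<in>J. i \<noteq> j \<longrightarrow> I i \<inter> I j = {}" using disj I(1) by blast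
  qed
  also have "\<dots> \<ge> (\<Sum>i\<in>J. (2 ^ \<mu>) ^ t)" using I(2) by (intro sum_mono) blast
  finally have "(2 ^ \<mu>) ^ Suc t \<le> card Z" using J(2) by simp
  moreover have "empty_on Z"
    unfolding empty_on_def
  proof (intro ballI impI, elim conjE)
    fix p q r assume pqr: "p \<in> Z" "q \<in> Z" "r \<in> Z" and ne: "p \<noteq> q" "p \<noteq> r" "q \<noteq> r"
    then obtain i j m where ijm: "i \<in> J" "j \<in> J" "m \<in> J" "p \<in> I i" "q \<in> I j" "r \<in> I m"
      unfolding Z_def by blast
    show "\<not> R p q r"
    proof (cases "i = j \<and> j = m")
      case True
      then show ?thesis using I(3)[OF ijm(1)] ijm ne unfolding empty_on_def by blast
    next
      case False
      have "p \<in> Y i" "q \<in> Y j" "r \<in> Y m" using I(1) ijm by blast+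
      then show ?thesis using cross ijm(1-3) False ne by blast
    qed
  qed
  ultimately show ?case using ZX by blast
qed

section \<open>Induction on the clique size\<close>

definition ramsey_bound :: "nat \<Rightarrow> nat \<Rightarrow> nat \<Rightarrow> bool" where
  "ramsey_bound s n l \<longleftrightarrow> (\<forall>V\<subseteq>U. finite V \<and> 2 ^ l \<le> card V \<longrightarrow>
     (\<exists>S\<subseteq>V. card S = s \<and> complete_on S) \<or> (\<exists>S\<subseteq>V. card S = n \<and> empty_on S))"

lemma ramsey_bound_0: "ramsey_bound 0 n l"
  unfolding ramsey_bound_def by (auto intro!: exI[of _ "{}"] simp: complete_on_def)

lemma complete_on_insert:
  assumes S: "complete_on S" "S \<subseteq> U" "q \<in> U" "q \<notin> S" and pw: "pairwise (\<lambda>p p'. R p p' q) S"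
  shows "complete_on (insert q S)"
  unfolding complete_on_def
proof (intro ballI impI, elim conjE)
  fix a b c assume abc: "a \<in> insert q S" "b \<in> insert q S" "c \<in> insert q S" "a \<noteq> b" "a \<noteq> c" "b \<noteq> c"
  then have U: "a \<in> U" "b \<in> U" "c \<in> U" using S by auto
  have pw': "R p p' q" if "p \<in> S" "p' \<in> S" "p \<noteq> p'" for p p' using pw that by (simp add: pairwise_def)
  note perm = R_perm[OF U abc(4-6)]
  show "R a b c"
  proof (cases "q \<in> {a, b, c}")
    case True
    then consider "c = q" | "b = q" | "a = q" by blast
    then show ?thesis
    proof cases
      case 1 then show ?thesis using pw'[of a b] abc by auto
    next
      case 2 then show ?thesis using pw'[of a c] abc perm(2) by auto
    next
      case 3 then show ?thesis using pw'[of b c] abc perm(3) by auto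
    qed
  next
    case False
    then show ?thesis using S(1) abc unfolding complete_on_def by blast
  qed
qed

text \<open>A clique \<open>W\<close> of the graph induced by \<open>q\<close> with more than
  \<open>2 ^ l\<close> points would contain, by the bound for \<open>s\<close>, an empty set of size
  \<open>n\<close> or a complete set of size \<open>s\<close> that \<open>q\<close> extends. This is
  why \<open>ramsey_bound\<close> speaks of all finite subsets of \<open>U\<close>. The last factor
  of the exponent adds up the three lower bounds on \<open>k\<close> in
  \<open>empty_by_iteration\<close>.\<close>

lemma ramsey_bound_Suc:
  assumes IH: "ramsey_bound s n l" and n: "n \<le> (2 ^ \<mu>) ^ t"
  shows "ramsey_bound (Suc s) n
    (shrink_factor \<mu> ^ t * (l * 2 ^ \<mu> + chain_cost ((2 ^ \<mu>) ^ Suc s) + 1))"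
  unfolding ramsey_bound_def
proof (intro allI impI, elim conjE)
  fix V assume V: "V \<subseteq> U" "finite V"
    and card: "2 ^ (shrink_factor \<mu> ^ t * (l * 2 ^ \<mu> + chain_cost ((2 ^ \<mu>) ^ Suc s) + 1)) \<le> card V"
  show "(\<exists>S\<subseteq>V. card S = Suc s \<and> complete_on S) \<or> (\<exists>S\<subseteq>V. card S = n \<and> empty_on S)"
  proof (rule ccontr)
    assume neg: "\<not> ?thesis"
    then have no_clique: "\<not> (\<exists>S\<subseteq>V. card S = Suc s \<and> complete_on S)" by blast
    have small': "card W \<le> 2 ^ l"
      if W: "W \<subseteq> V" "q \<in> V" "q \<notin> W" "pairwise (\<lambda>p p'. R p p' q) W" for W q
    proof (rule ccontr)
      assume "\<not> card W \<le> 2 ^ l"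
      moreover have WU: "W \<subseteq> U" "finite W" using W(1) V finite_subset by blast+
      ultimately consider S where "S \<subseteq> W" "card S = s" "complete_on S"
        | S where "S \<subseteq> W" "card S = n" "empty_on S"
        using IH unfolding ramsey_bound_def by (meson less_imp_le not_le)
      then show False
      proof cases
        case 1
        have q: "q \<in> U" "q \<notin> S" "S \<subseteq> U" "finite S" using W V(1) 1(1) WU finite_subset by blast+
        have "pairwise (\<lambda>p p'. R p p' q) S" using W(4) 1(1) pairwise_subset by blast
        then have "complete_on (insert q S)" using complete_on_insert 1(3) q by blast
        moreover have "card (insert q S) = Suc s" using 1(2) q by simp
        ultimately show False using no_clique W(1,2) 1(1) by (meson insert_subset subset_trans)
      next
        case 2
        then have "S \<subseteq> V" using W(1) by blast
        then show False using neg 2 by blast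
      qed
    qed
    then have small: "\<forall>W q. W \<subseteq> V \<and> q \<in> V \<and> q \<notin> W \<and> pairwise (\<lambda>p p'. R p p' q) W \<longrightarrow> card W \<le> 2 ^ l"
      by blast
    obtain I where I: "I \<subseteq> V" "(2 ^ \<mu>) ^ t \<le> card I" "empty_on I"
      using empty_by_iteration[OF V no_clique small _ _ _ order_refl card] by auto
    then have "n \<le> card I" using n by simp
    then obtain T where "T \<subseteq> I" "card T = n" using obtain_subset_with_card_n by metis
    moreover from this have "T \<subseteq> V" "empty_on T" using I empty_on_subset by blast+
    ultimately show False using neg by blast
  qed
qed

end

section \<open>The resulting bound\<close>

lemma of_nat_le_two_powr: "real m \<le> 2 powr real m"
proof -
  have "real m < real (2 ^ m)" using less_exp[of m] by (simp only: of_nat_less_iff)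
  then show ?thesis by (simp add: powr_realpow)
qed

text \<open>From \<open>n = 3\<close> on, \<open>log 2 L\<close> and \<open>g\<close> are bounded
  away from zero, so additive constants can be absorbed into multiples of them. At
  \<open>n = 2\<close> both vanish.\<close>

lemma loglog_facts:
  fixes n :: nat
  assumes n: "3 \<le> n"
  defines "L \<equiv> log 2 (real n)"
  defines "g \<equiv> sqrt (L * log 2 L)"
  shows "1 / 2 \<le> log 2 L" "log 2 L \<le> g" "g \<le> L" "1 / 2 \<le> g" "0 < L" "g * g = L * log 2 L"
proof -
  \<comment> \<open>Squaring reduces the numerical bounds to \<open>2^3 \<le> 3 * 3\<close> and
    \<open>2 \<le> (3 / 2) * (3 / 2)\<close>.\<close>
  have sq: "(2::real) powr x \<le> y" if "2 powr (2 * x) \<le> y * y" "0 \<le> y" for x y :: real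
  proof -
    have "(2 powr x)\<^sup>2 \<le> y\<^sup>2" using that(1) by (simp add: power2_eq_square powr_add[symmetric])
    then show ?thesis using that(2) power2_le_imp_le by blast
  qed
  have "(2::real) powr (3 / 2) \<le> 3" by (rule sq) simp_all
  then have "(2::real) powr (3 / 2) \<le> real n" using n by simp
  then have L: "3 / 2 \<le> L" unfolding L_def using n by (subst le_log_iff) auto
  have "(2::real) powr (1 / 2) \<le> 3 / 2" by (rule sq) simp_all
  then have "(2::real) powr (1 / 2) \<le> L" using L by simp
  then show half: "1 / 2 \<le> log 2 L" using L by (subst le_log_iff) auto
  show L0: "0 < L" using L by simp
  have "L \<le> real n" unfolding L_def using n of_nat_le_two_powr by (subst log_le_iff) auto
  then have LL: "log 2 L \<le> L" using L0 unfolding L_def by simp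
  have "0 \<le> L * log 2 L" by (rule mult_nonneg_nonneg) (use L0 half in linarith)+
  then show "g * g = L * log 2 L" unfolding g_def by (simp only: real_sqrt_mult_self abs_of_nonneg)
  show "log 2 L \<le> g" unfolding g_def
    by (rule real_le_rsqrt, unfold power2_eq_square, rule mult_right_mono[OF LL]) (use half in simp)
  show "g \<le> L" unfolding g_def
    by (rule real_le_lsqrt, unfold power2_eq_square, use L0 in simp, rule mult_left_mono[OF LL])
      (use L0 in simp)
  then show "1 / 2 \<le> g" using \<open>log 2 L \<le> g\<close> half by linarith
qed

text \<open>The left-hand side is the exponent of \<open>ramsey_bound_Suc\<close> with its
  definitions unfolded, \<open>K\<close> being \<open>parts_factor\<close>. Its first base is O(L) =
  2^(O(LL)), and \<open>g * g = L * LL\<close> yields \<open>LL * real t \<le> 2 * g\<close>; the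
  rest is of order \<open>l\<close> times a fixed power of \<open>2 ^ \<mu>\<close>. Thus
  \<open>c\<close> only increases by a number depending on \<open>C\<close>, \<open>K\<close> and
  \<open>s\<close>.\<close>

lemma exponent_recursion_bound:
  fixes C K l n s :: nat and c :: real
  assumes n: "3 \<le> n" and c: "0 \<le> c"
  defines "g \<equiv> sqrt (log 2 (real n) * log 2 (log 2 (real n)))"
  assumes l: "real l \<le> 2 powr (c * g)"
  obtains \<mu> t where "n \<le> (2 ^ \<mu>) ^ t"
    "real ((2 * K * (C * (\<mu> + 2) + 2)) ^ t *
        (l * 2 ^ \<mu> + (2 ^ \<mu>) ^ Suc s * (C * ((2 ^ \<mu>) ^ Suc s + 1) + 1) + 1))
     \<le> 2 powr ((2 * (2 * real (6 * K * (3 * C + 2)) + 1) + 2 * real (2 * C + 3) + c + 6 * real (Suc s)) * g)"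
proof -
  define L where "L = log 2 (real n)"
  define LL where "LL = log 2 L"
  have facts: "1 / 2 \<le> LL" "LL \<le> g" "g \<le> L" "1 / 2 \<le> g" "0 < L" "g * g = L * LL"
    using loglog_facts[OF n] by (simp_all add: L_def LL_def g_def)
  \<comment> \<open>Rounding up ensures \<open>L \<le> \<mu> * t\<close>, hence
    \<open>n \<le> (2 ^ \<mu>) ^ t\<close>; because of \<open>1 / 2 \<le> g\<close> it costs at most
    a factor 3 in \<open>\<mu>\<close>.\<close>
  define \<mu> where "\<mu> = nat \<lceil>g\<rceil>"
  define t where "t = nat \<lceil>L / g\<rceil>"
  have g0: "0 < g" using facts(4) by simp
  have \<mu>: "g \<le> real \<mu>" "real \<mu> \<le> 3 * g" using facts(4) unfolding \<mu>_def by linarith+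
  have t: "L / g \<le> real t" "real t \<le> L / g + 1"
    unfolding t_def using divide_pos_pos[OF facts(5) g0] by linarith+
  have "L = g * (L / g)" using g0 by simp
  also have "\<dots> \<le> real \<mu> * real t" using \<mu> t g0 facts(5) by (intro mult_mono) auto
  finally have "2 powr L \<le> 2 powr (real \<mu> * real t)" by simp
  then have "real n \<le> 2 powr real (\<mu> * t)" using n by (simp add: L_def)
  also have "\<dots> = real ((2 ^ \<mu>) ^ t)" by (simp only: powr_realpow) (simp add: power_mult)
  finally have main: "n \<le> (2 ^ \<mu>) ^ t" by (simp only: of_nat_le_iff)
  define Q where "Q = 2 * K * (3 * C + 2)"
  define A where "A = 3 * Q"
  have \<mu>1: "1 \<le> \<mu>" using \<mu>(1) g0 by linarith
  have "C * (\<mu> + 2) + 2 \<le> (3 * C + 2) * \<mu>"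
  proof -
    have "C * (\<mu> + 2) \<le> C * (3 * \<mu>)" using \<mu>1 by (intro mult_le_mono2) simp
    then show ?thesis using \<mu>1 by (simp add: add_mult_distrib)
  qed
  then have "2 * K * (C * (\<mu> + 2) + 2) \<le> 2 * K * ((3 * C + 2) * \<mu>)" by (rule mult_le_mono2)
  then have "2 * K * (C * (\<mu> + 2) + 2) \<le> Q * \<mu>" by (simp only: Q_def mult.assoc)
  then have "real (2 * K * (C * (\<mu> + 2) + 2)) \<le> real Q * real \<mu>" by (metis of_nat_le_iff of_nat_mult)
  also have "\<dots> \<le> real Q * (3 * L)" using \<mu>(2) facts(3) by (intro mult_left_mono) auto
  also have "\<dots> = real A * 2 powr LL" using facts(5) by (simp add: A_def LL_def)
  also have "\<dots> \<le> 2 powr real A * 2 powr LL"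
    by (intro mult_right_mono of_nat_le_two_powr) simp
  also have "\<dots> = 2 powr (real A + LL)" by (simp add: powr_add)
  also have "\<dots> \<le> 2 powr ((2 * real A + 1) * LL)"
  proof (rule powr_mono)
    have "real A * (1 / 2) \<le> real A * LL" using facts(1) by (intro mult_left_mono) auto
    then show "real A + LL \<le> (2 * real A + 1) * LL" by (simp add: algebra_simps)
  qed simp
  finally have "real (2 * K * (C * (\<mu> + 2) + 2)) ^ t \<le> (2 powr ((2 * real A + 1) * LL)) ^ t"
    by (intro power_mono) auto
  also have "\<dots> = 2 powr ((2 * real A + 1) * LL * real t)" by (simp add: powr_powr powr_realpow[symmetric])
  also have "\<dots> \<le> 2 powr ((2 * real A + 1) * (2 * g))"
  proof (rule powr_mono)
    have "LL * real t \<le> LL * (L / g + 1)" using t(2) facts(1) by (intro mult_left_mono) auto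
    also have "\<dots> = g + LL" using facts(6) g0 by (simp add: field_simps)
    also have "\<dots> \<le> 2 * g" using facts(2) by simp
    finally have "(2 * real A + 1) * (LL * real t) \<le> (2 * real A + 1) * (2 * g)" by (intro mult_left_mono) auto
    then show "(2 * real A + 1) * LL * real t \<le> (2 * real A + 1) * (2 * g)" by (simp only: mult.assoc)
  qed simp
  finally have part1: "real ((2 * K * (C * (\<mu> + 2) + 2)) ^ t) \<le> 2 powr ((2 * real A + 1) * (2 * g))" by simp
  define T :: nat where "T = (2 ^ \<mu>) ^ Suc s"
  have T1: "1 \<le> T" "2 ^ \<mu> \<le> T * T"
  proof -
    show "1 \<le> T" by (simp add: T_def)
    then have "2 ^ \<mu> * (1 * 1) \<le> 2 ^ \<mu> * ((2 ^ \<mu>) ^ s * T)" by (intro mult_le_mono) (auto simp: T_def)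
    then show "2 ^ \<mu> \<le> T * T" by (simp add: T_def mult.assoc)
  qed
  have TT: "T * 1 \<le> T * T" "1 \<le> T * T" using T1(1) by (intro mult_le_mono2; simp) (simp add: T_def)
  have "l * 2 ^ \<mu> + T * (C * (T + 1) + 1) + 1 = l * 2 ^ \<mu> + C * (T * T) + C * T + T + 1"
    by (simp add: algebra_simps)
  also have "\<dots> \<le> l * (T * T) + C * (T * T) + C * (T * T) + T * T + T * T"
    using TT T1 by (intro add_mono mult_le_mono2) auto
  also have "\<dots> = (l + 2 * C + 2) * (T * T)" by (simp add: algebra_simps)
  finally have "real (l * 2 ^ \<mu> + T * (C * (T + 1) + 1) + 1) \<le> real ((l + 2 * C + 2) * (T * T))"
    by (simp only: of_nat_le_iff)
  also have "\<dots> = (real l + real (2 * C + 2)) * real (T * T)"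
    by (simp only: of_nat_mult of_nat_add add.assoc)
  also have "\<dots> \<le> 2 powr ((2 * real (2 * C + 3) + c) * g) * 2 powr (6 * real (Suc s) * g)"
  proof (rule mult_mono)
    have "1 \<le> 2 powr (c * g)" using c g0 by (intro ge_one_powr_ge_zero) auto
    then have "real l + real (2 * C + 2) \<le> real (2 * C + 3) * 2 powr (c * g)"
      using l mult_left_mono[of 1 "2 powr (c * g)" "real (2 * C + 2)"] by (simp add: algebra_simps)
    also have "\<dots> \<le> 2 powr real (2 * C + 3) * 2 powr (c * g)"
      by (intro mult_right_mono of_nat_le_two_powr) simp
    also have "\<dots> = 2 powr (real (2 * C + 3) + c * g)" by (simp add: powr_add)
    also have "\<dots> \<le> 2 powr ((2 * real (2 * C + 3) + c) * g)"
    proof (rule powr_mono)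
      have "real (2 * C + 3) * (1 / 2) \<le> real (2 * C + 3) * g" using facts(4) by (intro mult_left_mono) auto
      then show "real (2 * C + 3) + c * g \<le> (2 * real (2 * C + 3) + c) * g" by (simp add: algebra_simps)
    qed simp
    finally show "real l + real (2 * C + 2) \<le> 2 powr ((2 * real (2 * C + 3) + c) * g)" .
    have "T * T = 2 ^ (\<mu> * Suc s + \<mu> * Suc s)" unfolding T_def power_mult[symmetric] power_add[symmetric] ..
    then have "real (T * T) = 2 powr real (\<mu> * Suc s + \<mu> * Suc s)" by (simp only: powr_realpow) simp
    also have "\<dots> \<le> 2 powr (6 * real (Suc s) * g)"
    proof (rule powr_mono)
      have "real (\<mu> * Suc s + \<mu> * Suc s) = 2 * (real (Suc s) * real \<mu>)" by (simp add: algebra_simps)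
      also have "\<dots> \<le> 2 * (real (Suc s) * (3 * g))" using \<mu>(2) by (intro mult_left_mono) auto
      finally show "real (\<mu> * Suc s + \<mu> * Suc s) \<le> 6 * real (Suc s) * g" by (simp add: algebra_simps)
    qed simp
    finally show "real (T * T) \<le> 2 powr (6 * real (Suc s) * g)" .
  qed auto
  finally have part2: "real (l * 2 ^ \<mu> + T * (C * (T + 1) + 1) + 1)
      \<le> 2 powr ((2 * real (2 * C + 3) + c) * g) * 2 powr (6 * real (Suc s) * g)" .
  have "real ((2 * K * (C * (\<mu> + 2) + 2)) ^ t * (l * 2 ^ \<mu> + T * (C * (T + 1) + 1) + 1))
      \<le> 2 powr ((2 * real A + 1) * (2 * g)) * (2 powr ((2 * real (2 * C + 3) + c) * g) * 2 powr (6 * real (Suc s) * g))"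
    unfolding of_nat_mult[of "(2 * K * (C * (\<mu> + 2) + 2)) ^ t"] by (rule mult_mono[OF part1 part2]) auto
  also have "\<dots> = 2 powr ((2 * (2 * real A + 1) + 2 * real (2 * C + 3) + c + 6 * real (Suc s)) * g)"
    by (simp only: powr_add[symmetric]) (simp add: algebra_simps)
  also have "A = 6 * K * (3 * C + 2)" by (simp add: A_def Q_def)
  finally show ?thesis using that[of \<mu> t, OF main] unfolding T_def by blast
qed

text \<open>The exponent \<open>l\<close> is chosen before \<open>U\<close> and \<open>R\<close>: in
  the induction step one value must serve all relations with the same \<open>C\<close>.\<close>

lemma ex_ramsey_exponent:
  "\<exists>c\<ge>0. \<forall>n\<ge>3. \<exists>l. real l \<le> 2 powr (c * sqrt (log 2 (real n) * log 2 (log 2 (real n)))) \<and>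
     (\<forall>(U :: 'a set) R. cuttable_relation C U R \<longrightarrow> cuttable_relation.ramsey_bound U R s n l)"
proof (induction s)
  case 0
  then show ?case by (intro exI[of _ 0]) (auto intro!: exI[of _ 0] cuttable_relation.ramsey_bound_0)
next
  case (Suc s)
  then obtain c where c: "0 \<le> c" and IH: "\<And>n. 3 \<le> n \<Longrightarrow>
     \<exists>l. real l \<le> 2 powr (c * sqrt (log 2 (real n) * log 2 (log 2 (real n)))) \<and>
     (\<forall>(U :: 'a set) R. cuttable_relation C U R \<longrightarrow> cuttable_relation.ramsey_bound U R s n l)" by blast
  define K where "K = cuttable_relation.parts_factor C"
  define c' where "c' = 2 * (2 * real (6 * K * (3 * C + 2)) + 1) + 2 * real (2 * C + 3) + c + 6 * real (Suc s)"
  have "\<exists>l. real l \<le> 2 powr (c' * sqrt (log 2 (real n) * log 2 (log 2 (real n)))) \<and>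
     (\<forall>(U :: 'a set) R. cuttable_relation C U R \<longrightarrow> cuttable_relation.ramsey_bound U R (Suc s) n l)"
    if n: "3 \<le> n" for n
  proof -
    obtain l where l: "real l \<le> 2 powr (c * sqrt (log 2 (real n) * log 2 (log 2 (real n))))"
      and ram: "\<forall>(U :: 'a set) R. cuttable_relation C U R \<longrightarrow> cuttable_relation.ramsey_bound U R s n l"
      using IH[OF n] by blast
    obtain \<mu> t where \<mu>: "n \<le> (2 ^ \<mu>) ^ t" and bound: "real ((2 * K * (C * (\<mu> + 2) + 2)) ^ t *
        (l * 2 ^ \<mu> + (2 ^ \<mu>) ^ Suc s * (C * ((2 ^ \<mu>) ^ Suc s + 1) + 1) + 1))
     \<le> 2 powr (c' * sqrt (log 2 (real n) * log 2 (log 2 (real n))))"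
      using exponent_recursion_bound[OF n c l] unfolding c'_def by blast
    have "cuttable_relation.ramsey_bound U R (Suc s) n ((2 * K * (C * (\<mu> + 2) + 2)) ^ t *
        (l * 2 ^ \<mu> + (2 ^ \<mu>) ^ Suc s * (C * ((2 ^ \<mu>) ^ Suc s + 1) + 1) + 1))"
      if "cuttable_relation C U R" for U :: "'a set" and R
    proof -
      interpret cuttable_relation C U R by (rule that)
      show ?thesis using ramsey_bound_Suc[of s n l \<mu> t] ram that \<mu>
        unfolding shrink_factor_def chain_cost_def K_def by blast
    qed
    then show ?thesis using bound by blast
  qed
  moreover have "0 \<le> c'" using c by (simp add: c'_def)
  ultimately show ?case by blast
qed

section \<open>Passage to point sets and the final bound\<close>

lemma ex_semialg_ramsey_prop_exponent:
  "\<exists>c\<ge>0. \<forall>n\<ge>3. \<exists>l. real l \<le> 2 powr (c * sqrt (log 2 (real n) * log 2 (log 2 (real n)))) \<and>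
     semialg_ramsey_prop d t 3 s n (2 ^ l)"
proof -
  obtain C where C: "\<forall>P E. symmetric_semialg_relation d t 3 P E \<longrightarrow>
    (\<exists>R. cuttable_relation C (set P) R \<and>
       (\<forall>p\<in>set P. \<forall>q\<in>set P. \<forall>r\<in>set P. p \<noteq> q \<and> p \<noteq> r \<and> q \<noteq> r \<longrightarrow> (R p q r \<longleftrightarrow> {p, q, r} \<in> E)))"
    using ex_cuttable_semialg ..
  obtain c where c: "0 \<le> c" and l: "\<forall>n\<ge>3. \<exists>l. real l \<le> 2 powr (c * sqrt (log 2 (real n) * log 2 (log 2 (real n)))) \<and>
     (\<forall>(U :: point set) R. cuttable_relation C U R \<longrightarrow> cuttable_relation.ramsey_bound U R s n l)"
    using ex_ramsey_exponent[of C s] by (elim exE conjE)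
  have ramsey: "semialg_ramsey_prop d t 3 s n (2 ^ l)"
    if ram: "\<forall>(U :: point set) R. cuttable_relation C U R \<longrightarrow> cuttable_relation.ramsey_bound U R s n l" for n l
    unfolding semialg_ramsey_prop_def
  proof (intro allI impI, elim conjE)
    fix P :: "point list" and E
    assume P: "length P = 2 ^ l" "distinct P" and sym: "symmetric_semialg_relation d t 3 P E"
    obtain R where cut: "cuttable_relation C (set P) R"
      and R: "\<And>p q r. \<lbrakk>p \<in> set P; q \<in> set P; r \<in> set P; p \<noteq> q; p \<noteq> r; q \<noteq> r\<rbrakk> \<Longrightarrow> R p q r \<longleftrightarrow> {p, q, r} \<in> E"
      using C[rule_format, OF sym] by blast
    interpret cuttable_relation C "set P" R by (rule cut)
    have "2 ^ l \<le> card (set P)" using P by (simp add: distinct_card)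
    then consider S where "S \<subseteq> set P" "card S = s" "complete_on S"
      | S where "S \<subseteq> set P" "card S = n" "empty_on S"
      using ram[rule_format, OF cut] unfolding ramsey_bound_def by blast
    then show "(\<exists>S\<subseteq>set P. card S = s \<and> nsets S 3 \<subseteq> E) \<or> (\<exists>T\<subseteq>set P. card T = n \<and> nsets T 3 \<inter> E = {})"
    proof cases
      case 1
      have "N \<in> E" if "N \<in> nsets S 3" for N
      proof -
        have "card N = 3" "N \<subseteq> S" using that by (simp_all add: nsets_def)
        then obtain p q r where N: "N = {p, q, r}" "p \<noteq> q" "p \<noteq> r" "q \<noteq> r"
          unfolding card_3_iff by blast
        then have "p \<in> S" "q \<in> S" "r \<in> S" using \<open>N \<subseteq> S\<close> by auto
        then have "R p q r" using 1(3) N unfolding complete_on_def by blast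
        then show ?thesis using R[of p q r] \<open>p \<in> S\<close> \<open>q \<in> S\<close> \<open>r \<in> S\<close> 1(1) N by blast
      qed
      then show ?thesis using 1 by blast
    next
      case 2
      have "N \<notin> E" if "N \<in> nsets S 3" for N
      proof -
        have "card N = 3" "N \<subseteq> S" using that by (simp_all add: nsets_def)
        then obtain p q r where N: "N = {p, q, r}" "p \<noteq> q" "p \<noteq> r" "q \<noteq> r"
          unfolding card_3_iff by blast
        then have "p \<in> S" "q \<in> S" "r \<in> S" using \<open>N \<subseteq> S\<close> by auto
        then have "\<not> R p q r" using 2(3) N unfolding empty_on_def by blast
        then show ?thesis using R[of p q r] \<open>p \<in> S\<close> \<open>q \<in> S\<close> \<open>r \<in> S\<close> 2(1) N by blast
      qed
      then show ?thesis using 2 by blast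
    qed
  qed
  show ?thesis using c l ramsey by (intro exI[of _ c] conjI allI impI) blast+
qed

lemma semialg_ramsey_le: "semialg_ramsey_prop d t k s n N \<Longrightarrow> semialg_ramsey d t k s n \<le> enat N"
  unfolding semialg_ramsey_def by (rule INF_lower) simp

theorem theorem4:
  fixes d t s :: nat
  assumes "d \<ge> 1" and "t \<ge> 1" and "s \<ge> 4"
  shows "(\<exists>c::real. c > 0 \<and>
            (\<forall>n::nat. n \<ge> 2 \<longrightarrow>
               ereal_of_enat (semialg_ramsey d t 3 s n)
                 \<le> ereal (2 powr (2 powr (c * sqrt (log 2 (real n) * log 2 (log 2 (real n))))))))
       \<and> (\<exists>\<epsilon>::nat \<Rightarrow> real. \<epsilon> \<in> o(\<lambda>_. 1) \<and>
            (\<forall>\<^sub>F n in sequentially.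
               ereal_of_enat (semialg_ramsey d t 3 s n) \<le> ereal (2 powr (real n powr \<epsilon> n))))"
proof -
  let ?g = "\<lambda>n::nat. sqrt (log 2 (real n) * log 2 (log 2 (real n)))"
  obtain c0 where c0: "0 \<le> c0" and l: "\<forall>n\<ge>3. \<exists>l. real l \<le> 2 powr (c0 * ?g n) \<and> semialg_ramsey_prop d t 3 s n (2 ^ l)"
    using ex_semialg_ramsey_prop_exponent[of d t s] by (elim exE conjE)
  \<comment> \<open>Only \<open>0 \<le> c0\<close> is known, and the constant has to be
    positive.\<close>
  define c where "c = c0 + 1"
  have large: "ereal_of_enat (semialg_ramsey d t 3 s n) \<le> ereal (2 powr (2 powr (c * ?g n)))" if n: "3 \<le> n" for n
  proof -
    obtain l where l: "real l \<le> 2 powr (c0 * ?g n)" "semialg_ramsey_prop d t 3 s n (2 ^ l)"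
      using l n by blast
    have "0 \<le> ?g n" using loglog_facts(4)[OF n] by linarith
    then have "2 powr (c0 * ?g n) \<le> 2 powr (c * ?g n)" by (intro powr_mono mult_right_mono) (auto simp: c_def)
    then have "real l \<le> 2 powr (c * ?g n)" by (rule order.trans[OF l(1)])
    then have "2 powr real l \<le> 2 powr (2 powr (c * ?g n))" by simp
    then have "real (2 ^ l) \<le> 2 powr (2 powr (c * ?g n))" by (simp add: powr_realpow)
    moreover have "ereal_of_enat (semialg_ramsey d t 3 s n) \<le> ereal_of_enat (enat (2 ^ l))"
      using semialg_ramsey_le[OF l(2)] by (simp only: ereal_of_enat_le_iff)
    ultimately show ?thesis by (simp add: order.trans)
  qed
  \<comment> \<open>Here \<open>log 2 (log 2 2) = 0\<close>, so the bound equals 2 exactly. It is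
    attained because two points span no triple.\<close>
  have two: "ereal_of_enat (semialg_ramsey d t 3 s 2) \<le> ereal (2 powr (2 powr (c * ?g 2)))"
  proof -
    have "semialg_ramsey_prop d t 3 s 2 2" unfolding semialg_ramsey_prop_def
    proof (intro allI impI disjI2, elim conjE)
      fix P :: "point list" and E assume P: "length P = 2" "distinct P"
      then have c: "card (set P) = 2" by (simp add: distinct_card)
      have "N \<notin> nsets (set P) 3" for N
      proof
        assume "N \<in> nsets (set P) 3"
        then have "N \<subseteq> set P" "card N = 3" by (auto simp: nsets_def)
        then show False using card_mono[of "set P" N] c by simp
      qed
      then have "nsets (set P) 3 = {}" by blast
      then show "\<exists>T\<subseteq>set P. card T = 2 \<and> nsets T 3 \<inter> E = {}" using c by blast
    qed
    from semialg_ramsey_le[OF this]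
    have "ereal_of_enat (semialg_ramsey d t 3 s 2) \<le> ereal_of_enat (enat 2)"
      by (simp only: ereal_of_enat_le_iff)
    then show ?thesis by simp
  qed
  \<comment> \<open>This is the exponent \<epsilon> for which \<open>real n powr \<epsilon>\<close>
    equals \<open>2 powr (c * ?g n)\<close>.\<close>
  have small_o: "(\<lambda>n::nat. c * ?g n / log 2 (real n)) \<in> o(\<lambda>_. 1)"
    by real_asymp
  have "ereal_of_enat (semialg_ramsey d t 3 s n) \<le> ereal (2 powr (real n powr (c * ?g n / log 2 (real n))))"
    if n: "3 \<le> n" for n
  proof -
    have "0 < log 2 (real n)" by (rule loglog_facts(5)[OF n])
    then have "real n powr (c * ?g n / log 2 (real n)) = 2 powr (c * ?g n)"
      using n powr_powr[of 2 "log 2 (real n)" "c * ?g n / log 2 (real n)"] by simp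
    then show ?thesis using large[OF n] by simp
  qed
  then have "\<forall>\<^sub>F n in sequentially. ereal_of_enat (semialg_ramsey d t 3 s n)
      \<le> ereal (2 powr (real n powr (c * ?g n / log 2 (real n))))"
    unfolding eventually_sequentially by blast
  moreover have "ereal_of_enat (semialg_ramsey d t 3 s n) \<le> ereal (2 powr (2 powr (c * ?g n)))" if "2 \<le> n" for n
    using large[of n] two that by (cases "n = 2") auto
  moreover have "0 < c" using c0 by (simp add: c_def)
  ultimately show ?thesis using small_o by blast
qed

end
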